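(* Let $(X,d_X)$ and $(Y,d_Y)$ be compact metric spaces, and let $\mathsf{L}_X$, $\mathsf{L}_Y$ be the Lipschitz seminorms on $\mathfrak{sa}(C(X))$, $\mathfrak{sa}(C(Y))$ associated with $d_X$, $d_Y$. Then $$\Lambda((C(X),\mathsf{L}_X),(C(Y),\mathsf{L}_Y))\le \mathrm{GH}((X,d_X),(Y,d_Y)),$$ where $\mathrm{GH}$ is the Gromov-Hausdorff distance.
   Context: For a compact metric space $(X,d)$, $\mathsf{L}_X(f)=\sup\{|f(x)-f(y)|/d(x,y): x\ne y\}$ for real-valued $f\in C(X)$ (possibly $\infty$); $(C(X),\mathsf{L}_X)$ is a Leibniz quantum compact metric space. $\mathrm{GH}((X,d_X),(Y,d_Y))$ is the infimum, over metrics $d$ on the disjoint union $X\sqcup Y$ restricting to $d_X$ and $d_Y$, of the Hausdorff distance between $X$ and $Y$ for $d$. Notation: $\mathfrak{sa}(\mathfrak{A})$ self-adjoint part, $\mathscr{S}(\mathfrak{A})$ state space. Quantum compact metric space $(\mathfrak{A},\mathsf{L})$: unital C*-algebra with a seminorm $\mathsf{L}$ on a dense subspace of $\mathfrak{sa}(\mathfrak{A})$ ($\infty$ elsewhere), vanishing exactly on $\mathbb{R}1_{\mathfrak{A}}$, with $\mathrm{mk}_{\mathsf{L}}(\varphi,\psi)=\sup\{|\varphi(a)-\psi(a)|:a\in\mathfrak{sa}(\mathfrak{A}),\mathsf{L}(a)\le1\}$ metrizing the weak* topology. Leibniz quantum compact metric space: additionally $\mathsf{L}$ is norm lower semi-continuous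 and $\mathsf{L}(\frac{ab+ba}{2}),\mathsf{L}(\frac{ab-ba}{2i})\le\|a\|\mathsf{L}(b)+\|b\|\mathsf{L}(a)$ for $a,b\in\mathfrak{sa}(\mathfrak{A})$; $\mathcal{L}^*$ is the class of these. $\mathrm{Lip}_1(\mathfrak{A},\mathsf{L})=\{a:\mathsf{L}(a)\le1\}$. $1$-level $\mathscr{S}_1(\omega)=\{\varphi\in\mathscr{S}(\mathfrak{D}):\varphi((1-\omega)^*(1-\omega))=0=\varphi((1-\omega)(1-\omega)^* )\}$. Bridge from $\mathfrak{A}$ to $\mathfrak{B}$: $(\mathfrak{D},\omega,\pi_{\mathfrak{A}},\pi_{\mathfrak{B}})$, $\mathfrak{D}$ unital C*-algebra, $\omega\in\mathfrak{D}$ with nonempty $1$-level, $\pi_{\mathfrak{A}},\pi_{\mathfrak{B}}$ unital injective *-homomorphisms into $\mathfrak{D}$. Reach: norm-Hausdorff distance between $\pi_{\mathfrak{A}}(\mathrm{Lip}_1(\mathfrak{A},\mathsf{L}_{\mathfrak{A}}))\omega$ and $\omega\pi_{\mathfrak{B}}(\mathrm{Lip}_1(\mathfrak{B},\mathsf{L}_{\mathfrak{B}}))$. Height: $\max\{\mathrm{Haus}_{\mathrm{mk}_{\mathsf{L}_{\mathfrak{A}}}}(\mathscr{S}(\mathfrak{A}),\{\varphi\circ\pi_{\mathfrak{A}}:\varphi\in\mathscr{S}_1(\omega)\}),\mathrm{Haus}_{\mathrm{mk}_{\mathsf{L}_{\mathfrak{B}}}}(\mathscr{S}(\mathfrak{B}),\{\varphi\circ\pi_{\mathfrak{B}}:\varphi\in\mathscr{S}_1(\omega)\})\}$.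 Length: max of reach and height. An $\mathcal{L}^*$-trek is a finite chain of bridges $\gamma_j$ from $\mathfrak{A}_j$ to $\mathfrak{A}_{j+1}$, $j=1,\dots,n$, through members $(\mathfrak{A}_j,\mathsf{L}_j)$ of $\mathcal{L}^*$ from the first space to the second; its length is the sum of bridge lengths. $\Lambda$ is the infimum of lengths of $\mathcal{L}^*$-treks. *)

theory Defs
  imports "HOL-Analysis.Analysis" "HOL-Library.Extended_Real"
begin

record 'a cstar =
  cset :: "'a set"
  czero :: 'a
  cone :: 'a
  cadd :: "'a \<Rightarrow> 'a \<Rightarrow> 'a"
  cneg :: "'a \<Rightarrow> 'a"
  csmul :: "complex \<Rightarrow> 'a \<Rightarrow> 'a"
  cmul :: "'a \<Rightarrow> 'a \<Rightarrow> 'a"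
  cstr :: "'a \<Rightarrow> 'a"
  cnrm :: "'a \<Rightarrow> real"

definition cdist :: "'a cstar \<Rightarrow> 'a \<Rightarrow> 'a \<Rightarrow> real" where
  "cdist A a b = cnrm A (cadd A a (cneg A b))"

definition unital_cstar_alg :: "'a cstar \<Rightarrow> bool" where
  "unital_cstar_alg A \<longleftrightarrow>
    czero A \<in> cset A \<and> cone A \<in> cset A \<and>
    (\<forall>a\<in>cset A. \<forall>b\<in>cset A. cadd A a b \<in> cset A \<and> cmul A a b \<in> cset A) \<and>
    (\<forall>a\<in>cset A. cneg A a \<in> cset A \<and> cstr A a \<in> cset A \<and> (\<forall>c. csmul A c a \<in> cset A)) \<and>
    \<comment> \<open>complex vector space\<close>
    (\<forall>a\<in>cset A. \<forall>b\<in>cset A. \<forall>c\<in>cset A. cadd A (cadd A a b) c = cadd A a (cadd A b c)) \<and>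
    (\<forall>a\<in>cset A. \<forall>b\<in>cset A. cadd A a b = cadd A b a) \<and>
    (\<forall>a\<in>cset A. cadd A (czero A) a = a \<and> cadd A a (cneg A a) = czero A) \<and>
    (\<forall>a\<in>cset A. \<forall>b\<in>cset A. \<forall>c. csmul A c (cadd A a b) = cadd A (csmul A c a) (csmul A c b)) \<and>
    (\<forall>a\<in>cset A. \<forall>c d. csmul A (c + d) a = cadd A (csmul A c a) (csmul A d a)) \<and>
    (\<forall>a\<in>cset A. \<forall>c d. csmul A c (csmul A d a) = csmul A (c * d) a) \<and>
    (\<forall>a\<in>cset A. csmul A 1 a = a) \<and>
    \<comment> \<open>unital associative algebra\<close>
    (\<forall>a\<in>cset A. \<forall>b\<in>cset A. \<forall>c\<in>cset A. cmul A (cmul A a b) c = cmul A a (cmul A b c)) \<and>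
    (\<forall>a\<in>cset A. \<forall>b\<in>cset A. \<forall>c\<in>cset A.
        cmul A a (cadd A b c) = cadd A (cmul A a b) (cmul A a c) \<and>
        cmul A (cadd A a b) c = cadd A (cmul A a c) (cmul A b c)) \<and>
    (\<forall>a\<in>cset A. \<forall>b\<in>cset A. \<forall>c.
        csmul A c (cmul A a b) = cmul A (csmul A c a) b \<and>
        csmul A c (cmul A a b) = cmul A a (csmul A c b)) \<and>
    (\<forall>a\<in>cset A. cmul A (cone A) a = a \<and> cmul A a (cone A) = a) \<and>
    \<comment> \<open>involution\<close>
    (\<forall>a\<in>cset A. cstr A (cstr A a) = a) \<and>
    (\<forall>a\<in>cset A. \<forall>b\<in>cset A. cstr A (cadd A a b) = cadd A (cstr A a) (cstr A b)) \<and>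
    (\<forall>a\<in>cset A. \<forall>c. cstr A (csmul A c a) = csmul A (cnj c) (cstr A a)) \<and>
    (\<forall>a\<in>cset A. \<forall>b\<in>cset A. cstr A (cmul A a b) = cmul A (cstr A b) (cstr A a)) \<and>
    \<comment> \<open>submultiplicative norm satisfying the C*-identity\<close>
    (\<forall>a\<in>cset A. cnrm A a \<ge> 0 \<and> (cnrm A a = 0 \<longleftrightarrow> a = czero A)) \<and>
    (\<forall>a\<in>cset A. \<forall>b\<in>cset A. cnrm A (cadd A a b) \<le> cnrm A a + cnrm A b) \<and>
    (\<forall>a\<in>cset A. \<forall>c. cnrm A (csmul A c a) = cmod c * cnrm A a) \<and>
    (\<forall>a\<in>cset A. \<forall>b\<in>cset A. cnrm A (cmul A a b) \<le> cnrm A a * cnrm A b) \<and>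
    (\<forall>a\<in>cset A. cnrm A (cmul A (cstr A a) a) = (cnrm A a)\<^sup>2) \<and>
    \<comment> \<open>completeness\<close>
    (\<forall>s::nat \<Rightarrow> 'a. (\<forall>n. s n \<in> cset A) \<longrightarrow>
        (\<forall>e>0. \<exists>N. \<forall>m\<ge>N. \<forall>n\<ge>N. cdist A (s m) (s n) < e) \<longrightarrow>
        (\<exists>l\<in>cset A. (\<lambda>n. cdist A (s n) l) \<longlonglongrightarrow> 0))"

definition sa :: "'a cstar \<Rightarrow> 'a set" where
  "sa A = {a \<in> cset A. cstr A a = a}"

definition real_units :: "'a cstar \<Rightarrow> 'a set" where
  "real_units A = {csmul A (complex_of_real r) (cone A) | r. True}"

definition states :: "'a cstar \<Rightarrow> ('a \<Rightarrow> complex) set" where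
  "states A = {\<phi>. (\<forall>a. a \<notin> cset A \<longrightarrow> \<phi> a = 0) \<and>
      (\<forall>a\<in>cset A. \<forall>b\<in>cset A. \<phi> (cadd A a b) = \<phi> a + \<phi> b) \<and>
      (\<forall>a\<in>cset A. \<forall>c. \<phi> (csmul A c a) = c * \<phi> a) \<and>
      (\<forall>a\<in>cset A. Im (\<phi> (cmul A (cstr A a) a)) = 0 \<and> Re (\<phi> (cmul A (cstr A a) a)) \<ge> 0) \<and>
      \<phi> (cone A) = 1}"

definition mk :: "'a cstar \<Rightarrow> ('a \<Rightarrow> ereal) \<Rightarrow> ('a \<Rightarrow> complex) \<Rightarrow> ('a \<Rightarrow> complex) \<Rightarrow> ereal" where
  "mk A L \<phi> \<psi> = Sup {ereal (cmod (\<phi> a - \<psi> a)) | a. a \<in> sa A \<and> L a \<le> 1}"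

definition weakstar :: "'a cstar \<Rightarrow> ('a \<Rightarrow> complex) topology" where
  "weakstar A = topology_generated_by {{\<phi>. \<phi> a \<in> U} | a U. a \<in> cset A \<and> open U}"

definition Lip1 :: "'a cstar \<Rightarrow> ('a \<Rightarrow> ereal) \<Rightarrow> 'a set" where
  "Lip1 A L = {a \<in> cset A. L a \<le> 1}"

definition qcms :: "'a cstar \<Rightarrow> ('a \<Rightarrow> ereal) \<Rightarrow> bool" where
  "qcms A L \<longleftrightarrow> unital_cstar_alg A \<and>
     (\<forall>a\<in>cset A. L a \<ge> 0) \<and>
     (\<forall>a\<in>cset A. L a < \<infinity> \<longrightarrow> a \<in> sa A) \<and>
     \<comment> \<open>domain is a real subspace of sa(A)\<close>
     (\<forall>a\<in>sa A. \<forall>b\<in>sa A. L a < \<infinity> \<longrightarrow> L b < \<infinity> \<longrightarrow>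
         L (cadd A a b) \<le> L a + L b) \<and>
     (\<forall>a\<in>sa A. \<forall>r::real. L a < \<infinity> \<longrightarrow>
         L (csmul A (complex_of_real r) a) = ereal \<bar>r\<bar> * L a) \<and>
     \<comment> \<open>domain dense in sa(A)\<close>
     (\<forall>a\<in>sa A. \<forall>e>0. \<exists>b\<in>sa A. L b < \<infinity> \<and> cdist A a b < e) \<and>
     \<comment> \<open>kernel is exactly the real multiples of the unit\<close>
     (\<forall>a\<in>sa A. L a = 0 \<longleftrightarrow> a \<in> real_units A) \<and>
     \<comment> \<open>mk metrizes the weak* topology on the state space\<close>
     (\<forall>\<phi>\<in>states A. \<forall>\<psi>\<in>states A. mk A L \<phi> \<psi> < \<infinity>) \<and>
     Metric_space (states A) (\<lambda>\<phi> \<psi>. real_of_ereal (mk A L \<phi> \<psi>)) \<and>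
     Metric_space.mtopology (states A) (\<lambda>\<phi> \<psi>. real_of_ereal (mk A L \<phi> \<psi>))
       = subtopology (weakstar A) (states A)"

definition leibniz_qcms :: "'a cstar \<Rightarrow> ('a \<Rightarrow> ereal) \<Rightarrow> bool" where
  "leibniz_qcms A L \<longleftrightarrow> qcms A L \<and>
     \<comment> \<open>norm lower semicontinuity: the sets {L <= r} are norm closed in sa(A)\<close>
     (\<forall>r::ereal. \<forall>s a. (\<forall>n. s n \<in> sa A \<and> L (s n) \<le> r) \<longrightarrow> a \<in> sa A \<longrightarrow>
         (\<lambda>n. cdist A (s n) a) \<longlonglongrightarrow> 0 \<longrightarrow> L a \<le> r) \<and>
     \<comment> \<open>Leibniz inequalities for the Jordan and Lie products\<close>
     (\<forall>a\<in>sa A. \<forall>b\<in>sa A.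
        L (csmul A (1/2) (cadd A (cmul A a b) (cmul A b a)))
          \<le> ereal (cnrm A a) * L b + ereal (cnrm A b) * L a \<and>
        L (csmul A (1/(2*\<i>)) (cadd A (cmul A a b) (cneg A (cmul A b a))))
          \<le> ereal (cnrm A a) * L b + ereal (cnrm A b) * L a)"

definition haus :: "('a \<Rightarrow> 'a \<Rightarrow> real) \<Rightarrow> 'a set \<Rightarrow> 'a set \<Rightarrow> ereal" where
  "haus d S T = max (SUP s\<in>S. INF t\<in>T. ereal (d s t)) (SUP t\<in>T. INF s\<in>S. ereal (d s t))"

definition unital_inj_star_hom :: "'a cstar \<Rightarrow> 'b cstar \<Rightarrow> ('a \<Rightarrow> 'b) \<Rightarrow> bool" where
  "unital_inj_star_hom A B \<pi> \<longleftrightarrow>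
     (\<forall>a\<in>cset A. \<pi> a \<in> cset B) \<and> inj_on \<pi> (cset A) \<and> \<pi> (cone A) = cone B \<and>
     (\<forall>a\<in>cset A. \<forall>b\<in>cset A. \<pi> (cadd A a b) = cadd B (\<pi> a) (\<pi> b) \<and>
                              \<pi> (cmul A a b) = cmul B (\<pi> a) (\<pi> b)) \<and>
     (\<forall>a\<in>cset A. \<forall>c. \<pi> (csmul A c a) = csmul B c (\<pi> a)) \<and>
     (\<forall>a\<in>cset A. \<pi> (cstr A a) = cstr B (\<pi> a))"

record ('x, 'y, 'u) bridge =
  bD :: "'u cstar"
  bw :: 'u
  bl :: "'x \<Rightarrow> 'u"
  br :: "'y \<Rightarrow> 'u"

definition one_level :: "'u cstar \<Rightarrow> 'u \<Rightarrow> ('u \<Rightarrow> complex) set" where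
  "one_level D w = {\<phi> \<in> states D.
      \<phi> (cmul D (cstr D (cadd D (cone D) (cneg D w))) (cadd D (cone D) (cneg D w))) = 0 \<and>
      \<phi> (cmul D (cadd D (cone D) (cneg D w)) (cstr D (cadd D (cone D) (cneg D w)))) = 0}"

definition is_bridge :: "'x cstar \<Rightarrow> 'y cstar \<Rightarrow> ('x, 'y, 'u) bridge \<Rightarrow> bool" where
  "is_bridge A B \<beta> \<longleftrightarrow> unital_cstar_alg (bD \<beta>) \<and> bw \<beta> \<in> cset (bD \<beta>) \<and>
     one_level (bD \<beta>) (bw \<beta>) \<noteq> {} \<and>
     unital_inj_star_hom A (bD \<beta>) (bl \<beta>) \<and> unital_inj_star_hom B (bD \<beta>) (br \<beta>)"

definition pullback :: "'x cstar \<Rightarrow> ('x \<Rightarrow> 'u) \<Rightarrow> ('u \<Rightarrow> complex) \<Rightarrow> ('x \<Rightarrow> complex)" where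
  "pullback A \<pi> \<phi> = (\<lambda>a. if a \<in> cset A then \<phi> (\<pi> a) else 0)"

definition bridge_reach :: "'x cstar \<Rightarrow> ('x \<Rightarrow> ereal) \<Rightarrow> 'y cstar \<Rightarrow> ('y \<Rightarrow> ereal)
     \<Rightarrow> ('x, 'y, 'u) bridge \<Rightarrow> ereal" where
  "bridge_reach A LA B LB \<beta> =
     haus (cdist (bD \<beta>))
       ((\<lambda>a. cmul (bD \<beta>) (bl \<beta> a) (bw \<beta>)) ` Lip1 A LA)
       ((\<lambda>b. cmul (bD \<beta>) (bw \<beta>) (br \<beta> b)) ` Lip1 B LB)"

definition bridge_height :: "'x cstar \<Rightarrow> ('x \<Rightarrow> ereal) \<Rightarrow> 'y cstar \<Rightarrow> ('y \<Rightarrow> ereal)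
     \<Rightarrow> ('x, 'y, 'u) bridge \<Rightarrow> ereal" where
  "bridge_height A LA B LB \<beta> =
     max (haus (\<lambda>\<phi> \<psi>. real_of_ereal (mk A LA \<phi> \<psi>)) (states A)
               (pullback A (bl \<beta>) ` one_level (bD \<beta>) (bw \<beta>)))
         (haus (\<lambda>\<phi> \<psi>. real_of_ereal (mk B LB \<phi> \<psi>)) (states B)
               (pullback B (br \<beta>) ` one_level (bD \<beta>) (bw \<beta>)))"

definition bridge_length :: "'x cstar \<Rightarrow> ('x \<Rightarrow> ereal) \<Rightarrow> 'y cstar \<Rightarrow> ('y \<Rightarrow> ereal)
     \<Rightarrow> ('x, 'y, 'u) bridge \<Rightarrow> ereal" where
  "bridge_length A LA B LB \<beta> = max (bridge_reach A LA B LB \<beta>) (bridge_height A LA B LB \<beta>)"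

text \<open>Lengths of L*-treks from (A,LA) to (B,LB). All intermediate spaces and all bridge
  algebras have carriers inside the universe type 'u.  A trek consists either of a single
  bridge, or of a first bridge into M_0, bridges M_i -> M_(i+1), and a last bridge M_(k-1) -> B.\<close>
definition trek_lengths :: "'u itself \<Rightarrow> 'x cstar \<Rightarrow> ('x \<Rightarrow> ereal) \<Rightarrow> 'y cstar \<Rightarrow> ('y \<Rightarrow> ereal)
     \<Rightarrow> ereal set" where
  "trek_lengths U A LA B LB =
     {bridge_length A LA B LB \<beta> | \<beta> :: ('x, 'y, 'u) bridge.
        leibniz_qcms A LA \<and> leibniz_qcms B LB \<and> is_bridge A B \<beta>}
   \<union>
     {bridge_length A LA (fst (M!0)) (snd (M!0)) \<beta>0
        + (\<Sum>i<length M - 1. bridge_length (fst (M!i)) (snd (M!i)) (fst (M!(i+1))) (snd (M!(i+1))) (\<beta>s!i))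
        + bridge_length (fst (M!(length M - 1))) (snd (M!(length M - 1))) B LB \<beta>1
      | (M :: ('u cstar \<times> ('u \<Rightarrow> ereal)) list) (\<beta>0 :: ('x, 'u, 'u) bridge)
        (\<beta>s :: ('u, 'u, 'u) bridge list) (\<beta>1 :: ('u, 'y, 'u) bridge).
        leibniz_qcms A LA \<and> leibniz_qcms B LB \<and>
        M \<noteq> [] \<and> length \<beta>s = length M - 1 \<and>
        (\<forall>i<length M. leibniz_qcms (fst (M!i)) (snd (M!i))) \<and>
        is_bridge A (fst (M!0)) \<beta>0 \<and>
        (\<forall>i<length M - 1. is_bridge (fst (M!i)) (fst (M!(i+1))) (\<beta>s!i)) \<and>
        is_bridge (fst (M!(length M - 1))) B \<beta>1}"

definition propinquity :: "'u itself \<Rightarrow> 'x cstar \<Rightarrow> ('x \<Rightarrow> ereal) \<Rightarrow> 'y cstar \<Rightarrow> ('y \<Rightarrow> ereal) \<Rightarrow> ereal" where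
  "propinquity U A LA B LB = Inf (trek_lengths U A LA B LB)"

definition CX :: "'a set \<Rightarrow> ('a \<Rightarrow> 'a \<Rightarrow> real) \<Rightarrow> ('a \<Rightarrow> complex) cstar" where
  "CX X d = \<lparr> cset = {f \<in> extensional X. continuous_map (Metric_space.mtopology X d) euclidean f},
     czero = restrict (\<lambda>x. 0) X,
     cone = restrict (\<lambda>x. 1) X,
     cadd = (\<lambda>f g. restrict (\<lambda>x. f x + g x) X),
     cneg = (\<lambda>f. restrict (\<lambda>x. - f x) X),
     csmul = (\<lambda>c f. restrict (\<lambda>x. c * f x) X),
     cmul = (\<lambda>f g. restrict (\<lambda>x. f x * g x) X),
     cstr = (\<lambda>f. restrict (\<lambda>x. cnj (f x)) X),
     cnrm = (\<lambda>f. Sup ((\<lambda>x. cmod (f x)) ` X)) \<rparr>"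

definition LipX :: "'a set \<Rightarrow> ('a \<Rightarrow> 'a \<Rightarrow> real) \<Rightarrow> ('a \<Rightarrow> complex) \<Rightarrow> ereal" where
  "LipX X d f = (if (\<forall>x\<in>X. Im (f x) = 0)
      then Sup (insert 0 {ereal (cmod (f x - f y) / d x y) | x y. x \<in> X \<and> y \<in> X \<and> x \<noteq> y})
      else \<infinity>)"

definition GH :: "'a set \<Rightarrow> ('a \<Rightarrow> 'a \<Rightarrow> real) \<Rightarrow> 'b set \<Rightarrow> ('b \<Rightarrow> 'b \<Rightarrow> real) \<Rightarrow> ereal" where
  "GH X dX Y dY = Inf {haus d (Inl ` X) (Inr ` Y) | d :: ('a + 'b) \<Rightarrow> ('a + 'b) \<Rightarrow> real.
      Metric_space (Inl ` X \<union> Inr ` Y) d \<and>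
      (\<forall>x\<in>X. \<forall>x'\<in>X. d (Inl x) (Inl x') = dX x x') \<and>
      (\<forall>y\<in>Y. \<forall>y'\<in>Y. d (Inr y) (Inr y') = dY y y')}"

end

theory Submission
  imports Defs
begin

text \<open>
  Fix an admissible metric \<open>d\<close> on the disjoint union and \<open>r\<close> larger than the Hausdorff distance. There are
  sequences \<open>x\<^sub>n\<close> and \<open>y\<^sub>n\<close>, dense in \<open>X\<close> and \<open>Y\<close>, with \<open>d (x\<^sub>n, y\<^sub>n) < r\<close> for all \<open>n\<close>. Sampling along
  them embeds \<open>C(X)\<close> and \<open>C(Y)\<close> into the bounded sequences, an algebra of cardinality continuum, and with
  pivot \<open>1\<close> this is a bridge of length at most \<open>r\<close>. The reach is at most \<open>r\<close> because McShane's formula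
  extends a 1-Lipschitz function on \<open>X\<close> to one on the disjoint union. The height is arbitrarily small
  because a partition of unity subordinate to small balls approximates any state, uniformly over
  1-Lipschitz functions, by a convex combination of evaluations at the sample points; no Hahn-Banach
  extension of states is needed. The same approximation shows that the Monge-Kantorovich metric
  induces the weak* topology, so that \<open>C(X)\<close> is a Leibniz quantum compact metric space.
\<close>

section \<open>Algebras of bounded functions\<close>

text \<open>The definition of \<open>trek_lengths\<close> confines every bridge algebra to the
  universe type \<open>'u\<close>, of which only an injection from \<open>real\<close> is given.
  Sequences suit this constraint: all of \<open>nat \<Rightarrow> complex\<close> injects into
  \<open>real\<close>, so the bridge algebra can be renamed into \<open>'u\<close> whatever the
  types of the points of the two spaces are. Sampling both spaces over one index set also replaces
  the relation of nearness between points by a list of matched pairs, and the norm of a difference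
  becomes a supremum over indices, with no topology to carry along. With pivot \<open>1\<close> the
  products in the reach are just the two images of the Lipschitz balls, and the 1-level is the whole
  state space. The height then only asks whether states of C(X) and C(Y) are approximated by
  restrictions of states of the sequence algebra. Since the Hausdorff distance is an infimum of
  suprema, arbitrarily good approximation is enough. Working with \<open>r\<close> strictly above
  the Hausdorff distance gives every point a partner without attaining an infimum, and makes
  \<open>r\<close> positive, so that it is itself an admissible tolerance for the height.\<close>

definition fun_cstar :: "'s set \<Rightarrow> ('s \<Rightarrow> complex) set \<Rightarrow> ('s \<Rightarrow> complex) cstar" where
  "fun_cstar S F = \<lparr> cset = F,
     czero = restrict (\<lambda>x. 0) S,
     cone = restrict (\<lambda>x. 1) S,
     cadd = (\<lambda>f g. restrict (\<lambda>x. f x + g x) S),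
     cneg = (\<lambda>f. restrict (\<lambda>x. - f x) S),
     csmul = (\<lambda>c f. restrict (\<lambda>x. c * f x) S),
     cmul = (\<lambda>f g. restrict (\<lambda>x. f x * g x) S),
     cstr = (\<lambda>f. restrict (\<lambda>x. cnj (f x)) S),
     cnrm = (\<lambda>f. Sup ((\<lambda>x. cmod (f x)) ` S)) \<rparr>"

text \<open>One set of assumptions serves both C(M) and the bounded sequences, so the C*-axioms are
  verified once. Completeness rests on \<open>unif_closed\<close>; scalar multiples and negatives
  come from \<open>const\<close> and \<open>mult\<close>.\<close>

locale fun_algebra =
  fixes S :: "'s set" and F :: "('s \<Rightarrow> complex) set"
  assumes nonempty: "S \<noteq> {}"
    and ext: "\<And>f. f \<in> F \<Longrightarrow> f \<in> extensional S"
    and bdd: "\<And>f. f \<in> F \<Longrightarrow> bdd_above ((\<lambda>x. cmod (f x)) ` S)"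
    and const: "\<And>c. restrict (\<lambda>x. c) S \<in> F"
    and add: "\<And>f g. f \<in> F \<Longrightarrow> g \<in> F \<Longrightarrow> restrict (\<lambda>x. f x + g x) S \<in> F"
    and mult: "\<And>f g. f \<in> F \<Longrightarrow> g \<in> F \<Longrightarrow> restrict (\<lambda>x. f x * g x) S \<in> F"
    and cnj: "\<And>f. f \<in> F \<Longrightarrow> restrict (\<lambda>x. cnj (f x)) S \<in> F"
    and unif_closed: "\<And>s l. (\<And>n::nat. s n \<in> F) \<Longrightarrow> l \<in> extensional S \<Longrightarrow>
          uniform_limit S s l sequentially \<Longrightarrow> l \<in> F"
begin

abbreviation sup_norm :: "('s \<Rightarrow> complex) \<Rightarrow> real" where
  "sup_norm f \<equiv> Sup ((\<lambda>x. cmod (f x)) ` S)"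

lemma smult: "f \<in> F \<Longrightarrow> restrict (\<lambda>x. c * f x) S \<in> F"
  using mult[OF const[of c]] by (simp cong: restrict_cong)

lemma neg: "f \<in> F \<Longrightarrow> restrict (\<lambda>x. - f x) S \<in> F"
  using smult[of f "-1"] by simp

lemma norm_le_sup_norm: "f \<in> F \<Longrightarrow> x \<in> S \<Longrightarrow> cmod (f x) \<le> sup_norm f"
  by (rule cSUP_upper) (auto simp: bdd)

lemma sup_norm_le: "(\<And>x. x \<in> S \<Longrightarrow> cmod (f x) \<le> B) \<Longrightarrow> sup_norm f \<le> B"
  by (rule cSUP_least) (auto simp: nonempty)

lemma sup_norm_nonneg: "f \<in> F \<Longrightarrow> 0 \<le> sup_norm f"
  using norm_le_sup_norm nonempty by (metis ex_in_conv norm_ge_zero order_trans)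

lemma sup_norm_eq_0_iff: "f \<in> F \<Longrightarrow> sup_norm f = 0 \<longleftrightarrow> f = restrict (\<lambda>x. 0) S"
proof
  assume "f \<in> F" "sup_norm f = 0"
  then show "f = restrict (\<lambda>x. 0) S"
    using norm_le_sup_norm ext[of f] by (intro extensionalityI[of _ S]) fastforce+
qed (simp add: nonempty cong: image_cong)

lemma sup_norm_smult:
  assumes "f \<in> F" shows "sup_norm (restrict (\<lambda>x. c * f x) S) = cmod c * sup_norm f"
proof (cases "c = 0")
  case True
  then show ?thesis by (simp add: nonempty cong: image_cong)
next
  case False
  have "sup_norm f \<le> sup_norm (restrict (\<lambda>x. c * f x) S) / cmod c"
    using norm_le_sup_norm[OF smult[OF assms, of c]] False
    by (intro sup_norm_le) (simp add: field_simps norm_mult)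
  moreover have "sup_norm (restrict (\<lambda>x. c * f x) S) \<le> cmod c * sup_norm f"
    by (intro sup_norm_le) (simp add: norm_mult mult_left_mono norm_le_sup_norm assms)
  ultimately show ?thesis
    using False by (simp add: field_simps)
qed

text \<open>The lower bound takes roots pointwise: the square of \<open>cmod (f x)\<close> is at
  most the norm of the product at every \<open>x\<close>, so the root of that norm bounds
  \<open>f\<close>.\<close>

lemma sup_norm_cstar:
  assumes "f \<in> F" shows "sup_norm (restrict (\<lambda>x. cnj (f x) * f x) S) = (sup_norm f)\<^sup>2"
proof (rule antisym)
  show "sup_norm (restrict (\<lambda>x. cnj (f x) * f x) S) \<le> (sup_norm f)\<^sup>2"
    using norm_le_sup_norm[OF assms]
    by (intro sup_norm_le) (simp add: norm_mult power2_eq_square mult_mono')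
  have "restrict (\<lambda>x. cnj (f x) * f x) S \<in> F"
    using mult[OF cnj[OF assms] assms] by (simp cong: restrict_cong)
  note le = norm_le_sup_norm[OF this]
  have "sup_norm f \<le> sqrt (sup_norm (restrict (\<lambda>x. cnj (f x) * f x) S))"
    using le by (intro sup_norm_le real_le_rsqrt) (simp add: norm_mult power2_eq_square)
  then show "(sup_norm f)\<^sup>2 \<le> sup_norm (restrict (\<lambda>x. cnj (f x) * f x) S)"
    using sup_norm_nonneg[OF assms] real_sqrt_le_iff
    by (metis abs_of_nonneg real_sqrt_abs)
qed

lemma cdist_fun_cstar: "cdist (fun_cstar S F) f g = sup_norm (\<lambda>x. f x - g x)"
  by (simp add: cdist_def fun_cstar_def cong: image_cong)

lemma diff: "f \<in> F \<Longrightarrow> g \<in> F \<Longrightarrow> restrict (\<lambda>x. f x - g x) S \<in> F"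
  using add[OF _ neg, of f g] by (simp cong: restrict_cong)

lemma norm_diff_le_cdist:
  "f \<in> F \<Longrightarrow> g \<in> F \<Longrightarrow> x \<in> S \<Longrightarrow> cmod (f x - g x) \<le> cdist (fun_cstar S F) f g"
  using norm_le_sup_norm[OF diff, of f g x] by (simp add: cdist_fun_cstar cong: image_cong)

lemma cdist_le:
  "(\<And>x. x \<in> S \<Longrightarrow> cmod (f x - g x) \<le> B) \<Longrightarrow> cdist (fun_cstar S F) f g \<le> B"
  unfolding cdist_fun_cstar by (rule sup_norm_le)

lemma complete:
  assumes s: "\<And>n. s n \<in> F"
    and C: "\<forall>e>0. \<exists>N. \<forall>m\<ge>N. \<forall>n\<ge>N. cdist (fun_cstar S F) (s m) (s n) < e"
  shows "\<exists>l\<in>F. (\<lambda>n. cdist (fun_cstar S F) (s n) l) \<longlonglongrightarrow> 0"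
proof -
  have "uniformly_Cauchy_on S s"
    unfolding uniformly_Cauchy_on_def dist_norm
    using C norm_diff_le_cdist[OF s s] by (meson order_le_less_trans)
  then obtain l where "uniform_limit S s l sequentially"
    using Cauchy_uniformly_convergent uniformly_convergent_on_def by blast
  then have u: "uniform_limit S s (restrict l S) sequentially"
    by (simp cong: uniform_limit_cong')
  have l: "restrict l S \<in> F"
    by (rule unif_closed[OF s _ u]) simp
  have "(\<lambda>n. cdist (fun_cstar S F) (s n) (restrict l S)) \<longlonglongrightarrow> 0"
  proof (rule LIMSEQ_I)
    fix e :: real assume "0 < e"
    \<comment> \<open>Half the tolerance, because a supremum of quantities below \<open>e/2\<close>
      is only known to be at most \<open>e/2\<close>.\<close>
    then obtain N where N: "\<And>n x. n \<ge> N \<Longrightarrow> x \<in> S \<Longrightarrow> dist (s n x) (restrict l S x) < e/2"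
      using uniform_limitD[OF u, of "e/2"] unfolding eventually_sequentially by force
    have "cdist (fun_cstar S F) (s n) (restrict l S) \<le> e/2" if "n \<ge> N" for n
      using N[OF that] by (intro cdist_le) (fastforce simp: dist_norm)
    moreover have "0 \<le> cdist (fun_cstar S F) (s n) (restrict l S)" for n
      using norm_diff_le_cdist[OF s l] nonempty by (metis ex_in_conv norm_ge_zero order_trans)
    ultimately show "\<exists>no. \<forall>n\<ge>no. norm (cdist (fun_cstar S F) (s n) (restrict l S) - 0) < e"
      using \<open>0 < e\<close> by (intro exI[of _ N]) (fastforce simp: abs_of_nonneg)
  qed
  with l show ?thesis by blast
qed

lemma unital_cstar_alg_fun_cstar: "unital_cstar_alg (fun_cstar S F)"
proof -
  have tri: "sup_norm (\<lambda>x. f x + g x) \<le> sup_norm f + sup_norm g"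
    if "f \<in> F" "g \<in> F" for f g
    using that by (intro sup_norm_le) (auto intro!: norm_triangle_le add_mono norm_le_sup_norm)
  have sub: "sup_norm (\<lambda>x. f x * g x) \<le> sup_norm f * sup_norm g"
    if "f \<in> F" "g \<in> F" for f g
    using that by (intro sup_norm_le)
      (auto simp: norm_mult intro!: mult_mono norm_le_sup_norm sup_norm_nonneg)
  have sc: "sup_norm (\<lambda>x. c * f x) = cmod c * sup_norm f" if "f \<in> F" for c f
    using sup_norm_smult[OF that] by simp
  have cs: "sup_norm (\<lambda>x. cnj (f x) * f x) = (sup_norm f)\<^sup>2" "sup_norm (\<lambda>x. f x * cnj (f x)) = (sup_norm f)\<^sup>2"
    if "f \<in> F" for f
    using sup_norm_cstar[OF that] by (simp_all add: mult.commute)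
  have compl: "\<forall>s. (\<forall>n. s n \<in> cset (fun_cstar S F)) \<longrightarrow>
        (\<forall>e>0. \<exists>N. \<forall>m\<ge>N. \<forall>n\<ge>N. cdist (fun_cstar S F) (s m) (s n) < e) \<longrightarrow>
        (\<exists>l\<in>cset (fun_cstar S F). (\<lambda>n. cdist (fun_cstar S F) (s n) l) \<longlonglongrightarrow> 0)"
    using complete by (simp add: fun_cstar_def)
  show ?thesis
    unfolding unital_cstar_alg_def
    by (intro conjI compl;
        simp add: fun_cstar_def const add mult smult neg cnj tri sub cs sc
          sup_norm_nonneg sup_norm_eq_0_iff;
        simp add: fun_eq_iff restrict_def algebra_simps extensional_arb[OF ext])
qed

end

section \<open>Transport of a C*-algebra along an injection\<close>

text \<open>A renaming of elements that moves the carrier into another type. Arguments are decoded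
  by \<open>inv J\<close>, whose values off the range of \<open>J\<close> are arbitrary; the carrier
  lies inside that range.\<close>

definition transport :: "('s \<Rightarrow> 'u) \<Rightarrow> 's cstar \<Rightarrow> 'u cstar" where
  "transport J A = \<lparr> cset = J ` cset A,
     czero = J (czero A),
     cone = J (cone A),
     cadd = (\<lambda>u v. J (cadd A (inv J u) (inv J v))),
     cneg = (\<lambda>u. J (cneg A (inv J u))),
     csmul = (\<lambda>c u. J (csmul A c (inv J u))),
     cmul = (\<lambda>u v. J (cmul A (inv J u) (inv J v))),
     cstr = (\<lambda>u. J (cstr A (inv J u))),
     cnrm = (\<lambda>u. cnrm A (inv J u)) \<rparr>"

lemma transport_sel:
  assumes "inj J"
  shows "cset (transport J A) = J ` cset A"
    and "czero (transport J A) = J (czero A)"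
    and "cone (transport J A) = J (cone A)"
    and "cadd (transport J A) (J a) (J b) = J (cadd A a b)"
    and "cneg (transport J A) (J a) = J (cneg A a)"
    and "csmul (transport J A) c (J a) = J (csmul A c a)"
    and "cmul (transport J A) (J a) (J b) = J (cmul A a b)"
    and "cstr (transport J A) (J a) = J (cstr A a)"
    and "cnrm (transport J A) (J a) = cnrm A a"
    and "cdist (transport J A) (J a) (J b) = cdist A a b"
  using assms by (simp_all add: transport_def cdist_def)

text \<open>A quantifier over the image of \<open>J\<close> becomes one over \<open>cset A\<close>,
  and each algebraic axiom then turns into the same axiom of \<open>A\<close>. Completeness is
  separate because a sequence in the image has to be lifted through \<open>J\<close> by
  choice.\<close>

lemma unital_cstar_alg_transport:
  assumes "inj J" "unital_cstar_alg A"
  shows "unital_cstar_alg (transport J A)"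
proof -
  have complete: "\<forall>s. (\<forall>n. s n \<in> cset A) \<longrightarrow>
        (\<forall>e>0. \<exists>N. \<forall>m\<ge>N. \<forall>n\<ge>N. cdist A (s m) (s n) < e) \<longrightarrow>
        (\<exists>l\<in>cset A. (\<lambda>n. cdist A (s n) l) \<longlonglongrightarrow> 0)"
    using assms(2) unfolding unital_cstar_alg_def by (elim conjE)
  have compl: "\<forall>s. (\<forall>n. s n \<in> J ` cset A) \<longrightarrow>
        (\<forall>e>0. \<exists>N. \<forall>m\<ge>N. \<forall>n\<ge>N. cdist (transport J A) (s m) (s n) < e) \<longrightarrow>
        (\<exists>l\<in>J ` cset A. (\<lambda>n. cdist (transport J A) (s n) l) \<longlonglongrightarrow> 0)"
  proof (intro allI impI)
    fix s :: "nat \<Rightarrow> 'b"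
    assume s: "\<forall>n. s n \<in> J ` cset A"
      and C: "\<forall>e>0. \<exists>N. \<forall>m\<ge>N. \<forall>n\<ge>N. cdist (transport J A) (s m) (s n) < e"
    have "\<forall>n. \<exists>a. a \<in> cset A \<and> s n = J a"
      using s by blast
    then obtain t where t: "\<And>n. t n \<in> cset A" "\<And>n. s n = J (t n)"
      by metis
    have "\<forall>e>0. \<exists>N. \<forall>m\<ge>N. \<forall>n\<ge>N. cdist A (t m) (t n) < e"
      using C by (simp only: t transport_sel[OF assms(1)])
    then have "\<exists>l\<in>cset A. (\<lambda>n. cdist A (t n) l) \<longlonglongrightarrow> 0"
      using t(1) by (intro complete[rule_format]) auto
    then show "\<exists>l\<in>J ` cset A. (\<lambda>n. cdist (transport J A) (s n) l) \<longlonglongrightarrow> 0"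
      by (simp only: t transport_sel[OF assms(1)] bex_simps(7))
  qed
  show ?thesis
    unfolding unital_cstar_alg_def transport_sel(1)[OF assms(1)]
    by (intro conjI compl;
        (simp (no_asm) only: ball_simps(9) transport_sel[OF assms(1)] inj_eq[OF assms(1)]
          inj_image_mem_iff[OF assms(1)]);
        insert assms(2)[unfolded unital_cstar_alg_def]; elim conjE; assumption)
qed

text \<open>A sequence is recovered from the rationals below the real and imaginary parts of its
  terms. These cuts form a subset of a countable type, hence a set of naturals, and sets of naturals
  inject into \<open>real\<close>.\<close>

lemma inj_sequences_complex_real: "\<exists>f :: (nat \<Rightarrow> complex) \<Rightarrow> real. inj f"
proof -
  define cut :: "(nat \<Rightarrow> complex) \<Rightarrow> (nat \<times> rat \<times> bool) set"
    where "cut s = {(n, q, b). of_rat q < (if b then Re (s n) else Im (s n))}" for s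
  have "inj cut"
  proof (rule injI, rule ext, rule complex_eqI)
    fix s t n assume eq: "cut s = cut t"
    have *: "x = y" if "\<And>q. of_rat q < x \<longleftrightarrow> of_rat q < y" for x y :: real
      using that of_rat_dense[of x y] of_rat_dense[of y x] by (metis less_asym linorder_less_linear)
    show "Re (s n) = Re (t n)" 
    proof (rule *)
      fix q show "of_rat q < Re (s n) \<longleftrightarrow> of_rat q < Re (t n)"
        using arg_cong[OF eq, of "\<lambda>A. (n, q, True) \<in> A"] by (simp add: cut_def)
    qed
    show "Im (s n) = Im (t n)"
    proof (rule *)
      fix q show "of_rat q < Im (s n) \<longleftrightarrow> of_rat q < Im (t n)"
        using arg_cong[OF eq, of "\<lambda>A. (n, q, False) \<in> A"] by (simp add: cut_def)
    qed
  qed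
  moreover have "inj ((`) (to_nat :: nat \<times> rat \<times> bool \<Rightarrow> nat))"
    by (simp add: inj_on_image_eq_iff inj_def inj_image_eq_iff)
  moreover obtain h :: "nat set \<Rightarrow> real" where "inj h"
    using nat_sets_eqpoll_reals unfolding eqpoll_def bij_betw_def by blast
  ultimately have "inj (h \<circ> ((`) to_nat \<circ> cut))"
    by (intro inj_compose)
  then show ?thesis by blast
qed

section \<open>Compact metric spaces\<close>

locale compact_metric = Metric_space M d for M :: "'a set" and d +
  assumes compact: "compact_space mtopology" and M_ne: "M \<noteq> {}"
begin

abbreviation cont :: "('a \<Rightarrow> real) \<Rightarrow> bool" where
  "cont g \<equiv> continuous_map mtopology euclideanreal g"

abbreviation lip :: "real \<Rightarrow> ('a \<Rightarrow> real) \<Rightarrow> bool" where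
  "lip L g \<equiv> (\<forall>x\<in>M. \<forall>y\<in>M. \<bar>g x - g y\<bar> \<le> L * d x y)"

abbreviation CM :: "('a \<Rightarrow> complex) set" where
  "CM \<equiv> {f \<in> extensional M. continuous_map mtopology euclidean f}"

text \<open>Self-adjoint elements are handled as plain real functions and become elements of C(M)
  only through \<open>emb\<close>; \<open>sa_CX\<close> shows that this reaches all of them.\<close>

definition emb :: "('a \<Rightarrow> real) \<Rightarrow> 'a \<Rightarrow> complex" where
  "emb g = restrict (\<lambda>x. complex_of_real (g x)) M"

lemma emb_apply [simp]: "x \<in> M \<Longrightarrow> emb g x = complex_of_real (g x)"
  by (simp add: emb_def)

lemma emb_extensional [simp]: "emb g \<in> extensional M"
  by (simp add: emb_def)

lemma continuous_map_metric_iff: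
  fixes f :: "'a \<Rightarrow> 'b::metric_space"
  shows "continuous_map mtopology euclidean f \<longleftrightarrow>
    (\<forall>a\<in>M. \<forall>\<epsilon>>0. \<exists>\<delta>>0. \<forall>x. x \<in> M \<and> d a x < \<delta> \<longrightarrow> dist (f a) (f x) < \<epsilon>)"
  using metric_continuous_map[OF Met_TC.Metric_space_axioms, of f] by simp

lemma continuous_map_complex_intros:
  fixes f g :: "'a \<Rightarrow> complex"
  assumes "continuous_map mtopology euclidean f"
  shows "continuous_map mtopology euclidean g \<Longrightarrow> continuous_map mtopology euclidean (\<lambda>x. f x * g x)"
    and "continuous_map mtopology euclidean (\<lambda>x. cnj (f x))"
    and "cont (\<lambda>x. Re (f x))" and "cont (\<lambda>x. Im (f x))" and "cont (\<lambda>x. cmod (f x))"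
proof -
  show "continuous_map mtopology euclidean (\<lambda>x. f x * g x)" if "continuous_map mtopology euclidean g"
    using assms that unfolding continuous_map_atin by (auto intro: tendsto_mult)
  have comp: "continuous_map mtopology euclidean (\<lambda>x. h (f x))" if "continuous_on UNIV h"
    for h :: "complex \<Rightarrow> 'c::topological_space"
    using continuous_map_compose[OF assms, of euclidean h] that by (simp add: o_def)
  show "continuous_map mtopology euclidean (\<lambda>x. cnj (f x))"
    by (intro comp continuous_intros)
  show "cont (\<lambda>x. cmod (f x))"
    by (intro continuous_map_norm assms)
  have comp: "cont (\<lambda>x. h (f x))" if "continuous_on UNIV h" for h
    using continuous_map_compose[OF assms, of euclidean h] that by (simp add: o_def)
  show "cont (\<lambda>x. Re (f x))" "cont (\<lambda>x. Im (f x))"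
    by (intro comp continuous_intros)+
qed

lemma cont_of_real:
  assumes "cont g" shows "continuous_map mtopology euclidean (\<lambda>x. complex_of_real (g x))"
  using continuous_map_compose[OF assms, of euclidean complex_of_real]
  by (simp add: o_def continuous_intros)

lemma cont_sqrt: "cont g \<Longrightarrow> cont (\<lambda>x. sqrt (g x))"
  using continuous_map_compose[of mtopology euclideanreal g euclideanreal sqrt]
  by (simp add: o_def continuous_on_real_sqrt)

lemma restrict_in_CM:
  "continuous_map mtopology euclidean f \<Longrightarrow> restrict f M \<in> CM"
  by (auto intro: continuous_map_eq)

lemma emb_in_CM: "cont g \<Longrightarrow> emb g \<in> CM"
  unfolding emb_def by (intro restrict_in_CM cont_of_real)

lemma cont_bounded:
  assumes "cont g" obtains B where "\<And>x. x \<in> M \<Longrightarrow> \<bar>g x\<bar> \<le> B"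
proof -
  have "compact (g ` M)"
    using image_compactin[OF _ assms, of M] compact by (simp add: compact_space_def)
  then show ?thesis
    using that compact_imp_bounded bounded_iff by (metis imageI real_norm_def)
qed

lemma lip_imp_cont:
  assumes "lip L g" shows "cont g"
  unfolding continuous_map_metric_iff
proof (intro ballI allI impI)
  fix a and e :: real assume "a \<in> M" "0 < e"
  \<comment> \<open>The denominator \<open>\<bar>L\<bar> + 1\<close> is positive for every real
    \<open>L\<close>, including \<open>0\<close>.\<close>
  have "dist (g a) (g x) < e" if "x \<in> M" "d a x < e / (\<bar>L\<bar> + 1)" for x
  proof -
    have "\<bar>g a - g x\<bar> \<le> L * d a x"
      using assms \<open>a \<in> M\<close> that by blast
    also have "\<dots> \<le> (\<bar>L\<bar> + 1) * d a x"
      by (intro mult_right_mono) auto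
    also have "\<dots> < e"
      using that by (simp add: field_simps)
    finally show ?thesis by (simp add: dist_real_def)
  qed
  then show "\<exists>\<delta>>0. \<forall>x. x \<in> M \<and> d a x < \<delta> \<longrightarrow> dist (g a) (g x) < e"
    using \<open>0 < e\<close> by (intro exI[of _ "e / (\<bar>L\<bar> + 1)"]) auto
qed

lemma abs_dist_diff_le:
  assumes "x \<in> M" "y \<in> M" "z \<in> M" shows "\<bar>d x z - d y z\<bar> \<le> d x y"
  using triangle[of x y z] triangle[of y x z] commute[of x y] assms by linarith

sublocale fun_algebra M CM
proof
  show "bdd_above ((\<lambda>x. cmod (f x)) ` M)" if "f \<in> CM" for f
  proof -
    have "cont (\<lambda>x. cmod (f x))"
      using that by (intro continuous_map_complex_intros) auto
    then show ?thesis
      by (rule cont_bounded) (auto intro!: bdd_aboveI)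
  qed
  show "restrict (\<lambda>x. f x * g x) M \<in> CM" "restrict (\<lambda>x. f x + g x) M \<in> CM"
    if "f \<in> CM" "g \<in> CM" for f g
    using that by (intro restrict_in_CM continuous_map_complex_intros continuous_map_add; simp)+
  show "restrict (\<lambda>x. cnj (f x)) M \<in> CM" if "f \<in> CM" for f
    using that by (intro restrict_in_CM continuous_map_complex_intros; simp)
  show "l \<in> CM" if "\<And>n. s n \<in> CM" "l \<in> extensional M" "uniform_limit M s l sequentially" for s l
  proof -
    have "continuous_map mtopology Met_TC.mtopology l"
      using that uniform_limitD[OF that(3)]
      by (intro Met_TC.continuous_map_uniform_limit[where F = sequentially and f = s]) auto
    then show ?thesis using that by simp
  qed
qed (auto simp: M_ne)

lemma CX_eq: "CX M d = fun_cstar M CM"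
  by (simp add: CX_def fun_cstar_def)

lemma CX_sel:
  "cset (CX M d) = CM"
  "czero (CX M d) = restrict (\<lambda>x. 0) M"
  "cone (CX M d) = restrict (\<lambda>x. 1) M"
  "cadd (CX M d) f g = restrict (\<lambda>x. f x + g x) M"
  "cneg (CX M d) f = restrict (\<lambda>x. - f x) M"
  "csmul (CX M d) c f = restrict (\<lambda>x. c * f x) M"
  "cmul (CX M d) f g = restrict (\<lambda>x. f x * g x) M"
  "cstr (CX M d) f = restrict (\<lambda>x. cnj (f x)) M"
  "cnrm (CX M d) f = Sup ((\<lambda>x. cmod (f x)) ` M)"
  by (simp_all add: CX_def)

lemma bounded_metric:
  obtains D where "D > 0" "\<And>x y. x \<in> M \<Longrightarrow> y \<in> M \<Longrightarrow> d x y \<le> D"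
  using compactin_imp_mbounded[of M] compact unfolding mbounded_alt_pos
  by (auto simp: compact_space_def)

text \<open>The inf-convolution of \<open>g\<close> with \<open>L \<cdot> d\<close> is \<open>L\<close>-Lipschitz and, for large \<open>L\<close>, uniformly close to \<open>g\<close>.\<close>
lemma lip_dense:
  assumes "cont g" "0 < e"
  obtains L h where "0 < L" "lip L h" "\<And>x. x \<in> M \<Longrightarrow> \<bar>g x - h x\<bar> \<le> e"
proof -
  obtain B where B: "\<And>x. x \<in> M \<Longrightarrow> \<bar>g x\<bar> \<le> B"
    using cont_bounded[OF assms(1)] by blast
  have "uniformly_continuous_map (metric (M, d)) euclidean_metric g"
    using assms(1) compact by (intro continuous_imp_uniformly_continuous_map) (simp add: mtopology_of_def)
  then obtain t where t: "t > 0" "\<And>x y. x \<in> M \<Longrightarrow> y \<in> M \<Longrightarrow> d y x < t \<Longrightarrow> dist (g y) (g x) < e"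
    using assms(2) unfolding uniformly_continuous_map_def by (simp, metis)
  have "0 \<le> B" using B M_ne by fastforce
  \<comment> \<open>A point at distance at least \<open>t\<close> pays a penalty of at least
    \<open>2 * B\<close>, the largest possible oscillation of \<open>g\<close>, so it cannot pull
    the infimum below \<open>g x\<close>; nearer points are handled by uniform continuity. The
    \<open>+ 1\<close> keeps \<open>L\<close> positive when \<open>B = 0\<close>.\<close>
  define L where "L = (2 * B + 1) / t"
  have L: "0 < L" "L * t \<ge> 2 * B"
    using t \<open>0 \<le> B\<close> by (simp_all add: L_def)
  define h where "h x = (INF z\<in>M. g z + L * d x z)" for x
  have bd: "bdd_below ((\<lambda>z. g z + L * d x z) ` M)" for x
  proof (rule bdd_belowI2)
    fix z assume "z \<in> M" then show "- B \<le> g z + L * d x z"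
      using B[of z] mult_nonneg_nonneg[of L "d x z"] L nonneg[of x z] by linarith
  qed
  have hle: "h x \<le> g z + L * d x z" if "z \<in> M" for x z
    unfolding h_def by (rule cINF_lower[OF bd that])
  have hge: "c \<le> h x" if "\<And>z. z \<in> M \<Longrightarrow> c \<le> g z + L * d x z" for c x
    unfolding h_def by (rule cINF_greatest[OF M_ne that])
  have half: "h x - L * d x y \<le> h y" if "x \<in> M" "y \<in> M" for x y
  proof (rule hge)
    fix z assume "z \<in> M"
    have "L * d x z \<le> L * (d x y + d y z)"
      using triangle that \<open>z \<in> M\<close> L by (intro mult_left_mono) auto
    then show "h x - L * d x y \<le> g z + L * d y z"
      using hle[OF \<open>z \<in> M\<close>, of x] by (simp add: algebra_simps)
  qed
  have "lip L h"
  proof (intro ballI)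
    fix x y assume "x \<in> M" "y \<in> M"
    then show "\<bar>h x - h y\<bar> \<le> L * d x y"
      using half[of x y] half[of y x] commute[of x y] by (simp add: abs_le_iff)
  qed
  moreover have "\<bar>g x - h x\<bar> \<le> e" if "x \<in> M" for x
  proof -
    have "g x - e \<le> h x"
    proof (rule hge)
      fix z assume z: "z \<in> M"
      show "g x - e \<le> g z + L * d x z"
      proof (cases "d x z < t")
        case True
        then have "g x - e \<le> g z"
          using t(2)[OF z that] by (auto simp: dist_real_def)
        moreover have "0 \<le> L * d x z" using L by simp
        ultimately show ?thesis by linarith
      next
        case False
        then have "2 * B \<le> L * d x z"
          using L mult_left_mono[of t "d x z" L] by linarith
        then show ?thesis
          using B[OF z] B[OF that] assms(2) by (simp add: abs_le_iff)
      qed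
    qed
    moreover have "h x \<le> g x"
      using hle[OF that, of x] that by simp
    ultimately show ?thesis using assms(2) by simp
  qed
  ultimately show ?thesis
    using that L by blast
qed

text \<open>The index of each function is the centre of the ball containing its support. This
  supplies the evaluation points of the convex combinations that approximate states.\<close>

definition subordinate_partition :: "real \<Rightarrow> 'a set \<Rightarrow> ('a \<Rightarrow> 'a \<Rightarrow> real) \<Rightarrow> bool" where
  "subordinate_partition e K p \<longleftrightarrow> finite K \<and> K \<subseteq> M \<and>
     (\<forall>k\<in>K. cont (p k)) \<and> (\<forall>k\<in>K. \<forall>x\<in>M. 0 \<le> p k x) \<and>
     (\<forall>x\<in>M. (\<Sum>k\<in>K. p k x) = 1) \<and> (\<forall>k\<in>K. \<forall>x\<in>M. p k x \<noteq> 0 \<longrightarrow> d k x < e)"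

text \<open>Tent functions on a finite subcover by balls, divided by their sum, which is positive
  because the balls cover. The centres are confined to a prescribed \<open>S\<close> so that
  \<open>height_le\<close> can take them among the sample points.\<close>

lemma subordinate_partition_exists:
  assumes "0 < e" and S: "S \<subseteq> M" and dense: "\<And>x. x \<in> M \<Longrightarrow> \<exists>s\<in>S. d x s < e"
  obtains K p where "K \<subseteq> S" "subordinate_partition e K p"
proof -
  have "\<exists>\<F>. finite \<F> \<and> \<F> \<subseteq> (\<lambda>s. mball s e) ` S \<and> topspace mtopology \<subseteq> \<Union>\<F>"
  proof (rule compact_space_alt[THEN iffD1, OF compact, rule_format], intro conjI ballI)
    show "topspace mtopology \<subseteq> (\<Union>s\<in>S. mball s e)"
      using dense S commute by (fastforce simp: in_mball)
  qed auto
  then obtain K where K: "K \<subseteq> S" "finite K" "M \<subseteq> (\<Union>k\<in>K. mball k e)"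
    by (metis finite_subset_image topspace_mtopology)
  define q where "q k x = max 0 (e - d k x)" for k x
  define p where "p k x = q k x / (\<Sum>j\<in>K. q j x)" for k x
  have q0: "0 \<le> q k x" for k x by (simp add: q_def)
  have Q: "0 < (\<Sum>j\<in>K. q j x)" if x: "x \<in> M" for x
  proof -
    obtain k where "k \<in> K" "d k x < e" using K x by auto
    then show ?thesis using K q0 by (intro sum_pos2[of _ k]) (auto simp: q_def)
  qed
  have dc: "cont (d k)" if "k \<in> K" for k
  proof (rule lip_imp_cont[where L = 1])
    show "lip 1 (d k)"
      using abs_dist_diff_le that K S by (auto simp: commute[of k])
  qed
  have qc: "cont (q k)" if "k \<in> K" for k
    unfolding q_def using dc[OF that]
    by (intro continuous_map_real_max continuous_map_diff continuous_map_canonical_const)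
  have "cont (p k)" if "k \<in> K" for k
    unfolding p_def using K qc that less_imp_neq[OF Q]
    by (intro continuous_map_real_divide continuous_map_sum) fastforce+
  moreover have "(\<Sum>k\<in>K. p k x) = 1" if "x \<in> M" for x
    using Q[OF that] by (simp add: p_def flip: sum_divide_distrib)
  moreover have "0 \<le> p k x" if "x \<in> M" for k x
    using q0 Q[OF that] by (simp add: p_def)
  moreover have "d k x < e" if "p k x \<noteq> 0" for k x
    using that by (auto simp: p_def q_def max_def split: if_splits)
  ultimately have "subordinate_partition e K p"
    using K S by (auto simp: subordinate_partition_def)
  then show ?thesis using that K by blast
qed

section \<open>States of C(M)\<close>

text \<open>Keeping only the real part loses nothing: by \<open>state_emb\<close> a state is real on
  continuous real functions.\<close>

abbreviation expect :: "(('a \<Rightarrow> complex) \<Rightarrow> complex) \<Rightarrow> ('a \<Rightarrow> real) \<Rightarrow> real" where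
  "expect \<phi> g \<equiv> Re (\<phi> (emb g))"

lemma state_linear:
  assumes "\<phi> \<in> states (CX M d)"
  shows "f \<in> CM \<Longrightarrow> g \<in> CM \<Longrightarrow> \<phi> (restrict (\<lambda>x. f x + g x) M) = \<phi> f + \<phi> g"
    and "f \<in> CM \<Longrightarrow> \<phi> (restrict (\<lambda>x. c * f x) M) = c * \<phi> f"
    and "\<phi> (restrict (\<lambda>x. 1) M) = 1"
    and "f \<notin> CM \<Longrightarrow> \<phi> f = 0"
  using assms unfolding states_def CX_sel by blast+

lemma expect_add:
  assumes "\<phi> \<in> states (CX M d)" "cont f" "cont g"
  shows "\<phi> (emb (\<lambda>x. f x + g x)) = \<phi> (emb f) + \<phi> (emb g)"
  using state_linear(1)[OF assms(1) emb_in_CM[OF assms(2)] emb_in_CM[OF assms(3)]]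
  by (simp add: emb_def cong: restrict_cong)

lemma expect_scale:
  assumes "\<phi> \<in> states (CX M d)" "cont f"
  shows "\<phi> (emb (\<lambda>x. c * f x)) = of_real c * \<phi> (emb f)"
  using state_linear(2)[OF assms(1) emb_in_CM[OF assms(2)], of "of_real c"]
  by (simp add: emb_def cong: restrict_cong)

lemma expect_const:
  assumes "\<phi> \<in> states (CX M d)"
  shows "\<phi> (emb (\<lambda>x. c)) = of_real c"
  using expect_scale[OF assms, of "\<lambda>_. 1" c] state_linear(3)[OF assms] by (simp add: emb_def)

lemma expect_diff:
  assumes "\<phi> \<in> states (CX M d)" "cont f" "cont g"
  shows "\<phi> (emb (\<lambda>x. f x - g x)) = \<phi> (emb f) - \<phi> (emb g)"
  using expect_add[OF assms(1,2), of "\<lambda>x. - 1 * g x"] expect_scale[OF assms(1,3), of "-1"]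
    continuous_map_real_mult_left[OF assms(3), of "-1"] by simp

lemma expect_sum:
  assumes "\<phi> \<in> states (CX M d)" "finite K" "\<And>k. k \<in> K \<Longrightarrow> cont (f k)"
  shows "\<phi> (emb (\<lambda>x. \<Sum>k\<in>K. f k x)) = (\<Sum>k\<in>K. \<phi> (emb (f k)))"
  using assms(2,3)
proof (induction K rule: finite_induct)
  case empty
  show ?case
    unfolding sum.empty using expect_const[OF assms(1), of 0] by simp
next
  case (insert k K)
  have "cont (\<lambda>x. \<Sum>k\<in>K. f k x)"
    using insert by (intro continuous_map_sum) auto
  then show ?case
    using insert expect_add[OF assms(1), of "f k" "\<lambda>x. \<Sum>k\<in>K. f k x"] by simp
qed

text \<open>Positivity of a state is postulated only on products of an adjoint with its element; the
  square root of \<open>g\<close> brings \<open>emb g\<close> into that form.\<close>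

lemma state_nonneg:
  assumes "\<phi> \<in> states (CX M d)" "cont g" "\<And>x. x \<in> M \<Longrightarrow> 0 \<le> g x"
  shows "Im (\<phi> (emb g)) = 0" "0 \<le> expect \<phi> g"
proof -
  let ?s = "emb (\<lambda>x. sqrt (g x))"
  have "cmul (CX M d) (cstr (CX M d) ?s) ?s = emb g"
    using assms(3) by (auto simp: CX_sel emb_def fun_eq_iff restrict_def simp flip: of_real_mult)
  moreover have "?s \<in> cset (CX M d)"
    unfolding CX_sel by (intro emb_in_CM cont_sqrt assms)
  ultimately show "Im (\<phi> (emb g)) = 0" "0 \<le> expect \<phi> g"
    using assms(1) unfolding states_def by force+
qed

text \<open>By compactness \<open>g\<close> becomes nonnegative after adding a constant, and a state
  is real on nonnegative functions and on constants.\<close>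

lemma state_emb:
  assumes "\<phi> \<in> states (CX M d)" "cont g"
  shows "\<phi> (emb g) = of_real (expect \<phi> g)"
proof -
  obtain B where B: "\<And>x. x \<in> M \<Longrightarrow> \<bar>g x\<bar> \<le> B"
    using cont_bounded[OF assms(2)] by blast
  have "Im (\<phi> (emb (\<lambda>x. g x + B))) = 0"
  proof (rule state_nonneg[OF assms(1)])
    show "cont (\<lambda>x. g x + B)"
      using assms by (intro continuous_map_add) auto
    show "0 \<le> g x + B" if "x \<in> M" for x
      using B[OF that] by linarith
  qed
  then have "Im (\<phi> (emb g)) = 0"
    using expect_add[OF assms, of "\<lambda>_. B"] expect_const[OF assms(1), of B] by simp
  then show ?thesis by (simp add: complex_eq_iff)
qed

lemma expect_mono:
  assumes "\<phi> \<in> states (CX M d)" "cont f" "cont g" "\<And>x. x \<in> M \<Longrightarrow> f x \<le> g x"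
  shows "expect \<phi> f \<le> expect \<phi> g"
  using state_nonneg(2)[OF assms(1), of "\<lambda>x. g x - f x"] expect_diff[OF assms(1,3,2)] assms
  by (simp add: continuous_map_diff)

lemma expect_abs_le:
  assumes "\<phi> \<in> states (CX M d)" "cont f" "\<And>x. x \<in> M \<Longrightarrow> \<bar>f x\<bar> \<le> B"
  shows "\<bar>expect \<phi> f\<bar> \<le> B"
proof -
  have "- B \<le> f x \<and> f x \<le> B" if "x \<in> M" for x
    using assms(3)[OF that] by linarith
  then have "expect \<phi> f \<le> expect \<phi> (\<lambda>_. B)" "expect \<phi> (\<lambda>_. - B) \<le> expect \<phi> f"
    by (intro expect_mono[OF assms(1)] assms(2) continuous_map_canonical_const; blast)+
  then show ?thesis
    using expect_const[OF assms(1)] by (simp add: abs_le_iff del: of_real_minus)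
qed

text \<open>The numbers \<open>expect \<phi> (p k)\<close> are the weights of the approximating
  convex combination. They play the part of masses of a representing measure, but come from
  linearity and positivity alone.\<close>

lemma expect_partition:
  assumes \<phi>: "\<phi> \<in> states (CX M d)" and p: "subordinate_partition e K p"
  shows "\<And>k. k \<in> K \<Longrightarrow> 0 \<le> expect \<phi> (p k)" and "(\<Sum>k\<in>K. expect \<phi> (p k)) = 1"
proof -
  show "0 \<le> expect \<phi> (p k)" if "k \<in> K" for k
    using p that by (intro state_nonneg[OF \<phi>]) (auto simp: subordinate_partition_def)
  have "(\<Sum>k\<in>K. \<phi> (emb (p k))) = \<phi> (emb (\<lambda>x. \<Sum>k\<in>K. p k x))"
    using p by (intro expect_sum[OF \<phi>, symmetric]) (auto simp: subordinate_partition_def)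
  also have "emb (\<lambda>x. \<Sum>k\<in>K. p k x) = emb (\<lambda>x. 1)"
    using p unfolding emb_def
    by (intro restrict_ext) (simp add: subordinate_partition_def del: of_real_sum)
  also have "\<phi> (emb (\<lambda>x. 1)) = 1"
    using expect_const[OF \<phi>, of 1] by simp
  finally show "(\<Sum>k\<in>K. expect \<phi> (p k)) = 1"
    unfolding Re_sum[symmetric] by (simp only: one_complex.sel)
qed

text \<open>Since \<open>g = \<Sum>\<^sub>k p\<^sub>k g\<close> and \<open>g\<close> varies by at most \<open>e\<close> on the support of \<open>p\<^sub>k\<close>, a state is
  \<open>e\<close>-close to a convex combination of evaluations, uniformly over 1-Lipschitz functions.\<close>
lemma expect_partition_approx:
  assumes \<phi>: "\<phi> \<in> states (CX M d)" and p: "subordinate_partition e K p" and g: "lip 1 g"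
  shows "\<bar>expect \<phi> g - (\<Sum>k\<in>K. g k * expect \<phi> (p k))\<bar> \<le> e"
proof -
  have cg: "cont g" by (rule lip_imp_cont[OF g])
  have K: "finite K" "K \<subseteq> M" and pc: "\<And>k. k \<in> K \<Longrightarrow> cont (p k)"
    and p0: "\<And>k x. k \<in> K \<Longrightarrow> x \<in> M \<Longrightarrow> 0 \<le> p k x"
    and p1: "\<And>x. x \<in> M \<Longrightarrow> (\<Sum>k\<in>K. p k x) = 1"
    and ps: "\<And>k x. k \<in> K \<Longrightarrow> x \<in> M \<Longrightarrow> p k x \<noteq> 0 \<Longrightarrow> d k x < e"
    using p by (auto simp: subordinate_partition_def)
  let ?h = "\<lambda>x. \<Sum>k\<in>K. g k * p k x"
  have hc: "cont ?h"
    using K pc by (intro continuous_map_sum continuous_map_real_mult_left) auto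
  have "\<bar>expect \<phi> (\<lambda>x. g x - ?h x)\<bar> \<le> e"
  proof (rule expect_abs_le[OF \<phi>])
    show "cont (\<lambda>x. g x - ?h x)" by (intro continuous_map_diff cg hc)
    fix x assume x: "x \<in> M"
    have "g x - ?h x = (\<Sum>k\<in>K. p k x * (g x - g k))"
      using p1[OF x] by (simp add: algebra_simps sum_subtractf flip: sum_distrib_left)
    also have "\<bar>\<dots>\<bar> \<le> (\<Sum>k\<in>K. p k x * e)"
    proof (rule order_trans[OF sum_abs sum_mono])
      fix k assume k: "k \<in> K"
      show "\<bar>p k x * (g x - g k)\<bar> \<le> p k x * e"
      proof (cases "p k x = 0")
        case False
        have "\<bar>g x - g k\<bar> \<le> d k x"
          using g k x K commute[of k x] by auto
        then have "\<bar>g x - g k\<bar> \<le> e"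
          using ps[OF k x False] by linarith
        then show ?thesis
          using p0[OF k x] by (simp add: abs_mult mult_left_mono)
      qed simp
    qed
    also have "\<dots> = e"
      using p1[OF x] by (simp flip: sum_distrib_right)
    finally show "\<bar>g x - ?h x\<bar> \<le> e" .
  qed
  moreover have "\<phi> (emb ?h) = (\<Sum>k\<in>K. of_real (g k) * \<phi> (emb (p k)))"
    using expect_sum[OF \<phi> K(1), of "\<lambda>k x. g k * p k x"] pc expect_scale[OF \<phi>]
    by (simp add: continuous_map_real_mult_left)
  ultimately show ?thesis
    using expect_diff[OF \<phi> cg hc] by simp
qed

lemma CM_decompose:
  assumes "a \<in> CM"
  shows "cont (\<lambda>x. Re (a x))" "cont (\<lambda>x. Im (a x))"
    and "a = restrict (\<lambda>x. emb (\<lambda>x. Re (a x)) x + restrict (\<lambda>x. \<i> * emb (\<lambda>x. Im (a x)) x) M x) M"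
proof -
  show "cont (\<lambda>x. Re (a x))" "cont (\<lambda>x. Im (a x))"
    using assms continuous_map_complex_intros by auto
  show "a = restrict (\<lambda>x. emb (\<lambda>x. Re (a x)) x + restrict (\<lambda>x. \<i> * emb (\<lambda>x. Im (a x)) x) M x) M"
    using assms by (intro extensionalityI[of _ M]) (auto simp: complex_eq_iff)
qed

lemma state_decompose:
  assumes "\<phi> \<in> states (CX M d)" "a \<in> CM"
  shows "\<phi> a = of_real (expect \<phi> (\<lambda>x. Re (a x))) + \<i> * of_real (expect \<phi> (\<lambda>x. Im (a x)))"
proof -
  note c = CM_decompose[OF assms(2)]
  have "\<phi> a = \<phi> (emb (\<lambda>x. Re (a x))) + \<i> * \<phi> (emb (\<lambda>x. Im (a x)))"
    by (subst c(3)) (use c(1,2) in \<open>simp only: state_linear[OF assms(1)] emb_in_CM smult\<close>)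
  then show ?thesis
    using state_emb[OF assms(1)] c by simp
qed

lemma sa_CX: "sa (CX M d) = {emb g | g. cont g}"
proof -
  have "\<exists>g. a = emb g \<and> cont g" if "a \<in> CM" "restrict (\<lambda>x. cnj (a x)) M = a" for a
  proof (intro exI conjI)
    show "cont (\<lambda>x. Re (a x))" by (rule CM_decompose[OF that(1)])
    have "Im (a x) = 0" if "x \<in> M" for x
      using that fun_cong[OF \<open>restrict (\<lambda>x. cnj (a x)) M = a\<close>, of x] by (simp add: complex_eq_iff)
    then show "a = emb (\<lambda>x. Re (a x))"
      using that(1) by (intro extensionalityI[of _ M]) (auto simp: complex_eq_iff)
  qed
  moreover have "restrict (\<lambda>x. cnj (emb g x)) M = emb g" for g
    by (auto simp: emb_def fun_eq_iff restrict_def)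
  ultimately show ?thesis
    unfolding sa_def CX_sel using emb_in_CM by blast
qed

section \<open>The Lipschitz seminorm and the Monge-Kantorovich metric\<close>

abbreviation LM :: "('a \<Rightarrow> complex) \<Rightarrow> ereal" where "LM \<equiv> LipX M d"

text \<open>The bound \<open>r\<close> is an extended real, so that lower semicontinuity and the
  Leibniz inequality can use it when the right-hand side is infinite. The conjunct
  \<open>0 \<le> r\<close> reflects the \<open>0\<close> inserted in \<open>LipX\<close>, which
  matters when there are no pairs of distinct points.\<close>

lemma LipX_emb_le_iff':
  "LM (emb g) \<le> r \<longleftrightarrow> 0 \<le> r \<and> (\<forall>x\<in>M. \<forall>y\<in>M. x \<noteq> y \<longrightarrow> ereal (\<bar>g x - g y\<bar> / d x y) \<le> r)"
proof -
  have "cmod (complex_of_real (g x) - complex_of_real (g y)) = \<bar>g x - g y\<bar>" for x y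
    by (metis norm_of_real of_real_diff)
  then have "ereal (cmod (emb g x - emb g y) / d x y) = ereal (\<bar>g x - g y\<bar> / d x y)"
    if "x \<in> M" "y \<in> M" for x y
    using that by simp
  then have "{ereal (cmod (emb g x - emb g y) / d x y) | x y. x \<in> M \<and> y \<in> M \<and> x \<noteq> y} =
      {ereal (\<bar>g x - g y\<bar> / d x y) | x y. x \<in> M \<and> y \<in> M \<and> x \<noteq> y}"
    by (intro Collect_cong) metis
  then have "LM (emb g) = Sup (insert 0 {ereal (\<bar>g x - g y\<bar> / d x y) | x y. x \<in> M \<and> y \<in> M \<and> x \<noteq> y})"
    unfolding LipX_def by simp
  then show ?thesis
    by (simp only: Sup_le_iff ball_simps(7)) blast
qed

lemma LipX_emb_le_iff: "LM (emb g) \<le> ereal r \<longleftrightarrow> 0 \<le> r \<and> lip r g"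
proof -
  have "(x \<noteq> y \<longrightarrow> \<bar>g x - g y\<bar> / d x y \<le> r) \<longleftrightarrow> \<bar>g x - g y\<bar> \<le> r * d x y"
    if "x \<in> M" "y \<in> M" for x y
  proof (cases "x = y")
    case False
    then have "0 < d x y" using that nonneg[of x y] by (simp add: less_le)
    then show ?thesis using False by (simp add: pos_divide_le_eq)
  qed (use that in simp)
  then show ?thesis
    unfolding LipX_emb_le_iff' by (auto simp: zero_ereal_def)
qed

lemma LipX_nonneg: "0 \<le> LM f"
  by (auto simp: LipX_def intro: Sup_upper)

lemma LipX_finite_imp_real: "LM f < \<infinity> \<Longrightarrow> f \<in> CM \<Longrightarrow> f \<in> sa (CX M d)"
  unfolding sa_def CX_sel
  by (auto simp: LipX_def complex_eq_iff split: if_splits intro!: extensionalityI[of _ M])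

text \<open>\<open>Lip1\<close> ranges over the whole carrier, but \<open>LipX\<close> is infinite
  off the real-valued functions, so only self-adjoint elements remain.\<close>

lemma Lip1_CX: "Lip1 (CX M d) LM = {emb g | g. lip 1 g}"
proof (intro equalityI subsetI)
  fix a assume "a \<in> Lip1 (CX M d) LM"
  then have a: "a \<in> CM" "LM a \<le> 1" by (auto simp: Lip1_def CX_sel)
  then have "LM a < \<infinity>" using order_le_less_trans by fastforce
  then obtain g where "a = emb g" using LipX_finite_imp_real a unfolding sa_CX by blast
  then show "a \<in> {emb g | g. lip 1 g}"
    using a LipX_emb_le_iff[of g 1] by (auto simp: one_ereal_def)
next
  fix a assume "a \<in> {emb g | g. lip 1 g}"
  then obtain g where g: "a = emb g" "lip 1 g" by blast
  then show "a \<in> Lip1 (CX M d) LM"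
    using LipX_emb_le_iff[of g 1] emb_in_CM[OF lip_imp_cont[OF g(2)]]
    by (simp add: one_ereal_def Lip1_def CX_sel)
qed

abbreviation mkd :: "(('a \<Rightarrow> complex) \<Rightarrow> complex) \<Rightarrow> (('a \<Rightarrow> complex) \<Rightarrow> complex) \<Rightarrow> real" where
  "mkd \<phi> \<psi> \<equiv> real_of_ereal (mk (CX M d) LM \<phi> \<psi>)"

lemma mk_eq: "mk (CX M d) LM \<phi> \<psi> = (SUP g\<in>{g. lip 1 g}. ereal (cmod (\<phi> (emb g) - \<psi> (emb g))))"
proof -
  have "{a. a \<in> sa (CX M d) \<and> LM a \<le> 1} = emb ` {g. lip 1 g}"
    using LipX_emb_le_iff[of _ 1] lip_imp_cont[where L = 1] unfolding sa_CX
    by (auto simp: one_ereal_def)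
  then show ?thesis
    by (simp add: mk_def setcompr_eq_image image_image)
qed

lemma lip_0: "lip 1 (\<lambda>_. 0)" by simp

lemma mk_nonneg: "0 \<le> mk (CX M d) LM \<phi> \<psi>"
  unfolding mk_eq by (rule SUP_upper2[of "\<lambda>_. 0"]) (use lip_0 in auto)

lemma mk_commute: "mk (CX M d) LM \<phi> \<psi> = mk (CX M d) LM \<psi> \<phi>"
  unfolding mk_eq by (simp add: norm_minus_commute)

lemma mk_refl: "mk (CX M d) LM \<phi> \<phi> = 0"
  by (rule antisym[OF _ mk_nonneg]) (auto simp: mk_eq intro: SUP_least)

lemma cmod_state_diff:
  assumes "\<phi> \<in> states (CX M d)" "\<psi> \<in> states (CX M d)" "cont g"
  shows "cmod (\<phi> (emb g) - \<psi> (emb g)) = \<bar>expect \<phi> g - expect \<psi> g\<bar>"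
  by (subst (1 2) state_emb) (use assms in \<open>auto simp flip: of_real_diff\<close>)

lemma mk_le:
  assumes "\<phi> \<in> states (CX M d)" "\<psi> \<in> states (CX M d)"
    and "\<And>g. lip 1 g \<Longrightarrow> \<bar>expect \<phi> g - expect \<psi> g\<bar> \<le> r"
  shows "mk (CX M d) LM \<phi> \<psi> \<le> ereal r"
  unfolding mk_eq
proof (rule SUP_least)
  fix g assume "g \<in> {g. lip 1 g}"
  then have g: "lip 1 g" by simp
  then show "ereal (cmod (\<phi> (emb g) - \<psi> (emb g))) \<le> ereal r"
    using assms(3)[OF g] unfolding cmod_state_diff[OF assms(1,2) lip_imp_cont[OF g]] by simp
qed

text \<open>The 1-Lipschitz functions have no common bound, but \<open>g - g x0\<close> is bounded
  by the diameter bound \<open>D\<close>. Hence every state is within \<open>D\<close> of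
  \<open>g x0\<close>, and two states are within \<open>2 * D\<close> of each other.\<close>

lemma mk_finite:
  assumes "\<phi> \<in> states (CX M d)" "\<psi> \<in> states (CX M d)"
  shows "mk (CX M d) LM \<phi> \<psi> < \<infinity>"
proof -
  obtain D where D: "\<And>x y. x \<in> M \<Longrightarrow> y \<in> M \<Longrightarrow> d x y \<le> D"
    using bounded_metric by blast
  obtain x0 where x0: "x0 \<in> M" using M_ne by blast
  have "\<bar>expect \<phi> g - expect \<psi> g\<bar> \<le> 2 * D" if g: "lip 1 g" for g
  proof -
    have "\<bar>expect \<rho> g - g x0\<bar> \<le> D" if \<rho>: "\<rho> \<in> states (CX M d)" for \<rho>
    proof -
      have c: "cont g" "cont (\<lambda>x. g x0)" using lip_imp_cont[OF g] by auto
      have "\<bar>expect \<rho> (\<lambda>x. g x - g x0)\<bar> \<le> D"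
        using g x0 D by (intro expect_abs_le[OF \<rho>] continuous_map_diff c) (metis mult_1 order_trans)
      then show ?thesis
        using expect_diff[OF \<rho> c] expect_const[OF \<rho>, of "g x0"] by simp
    qed
    from this[OF assms(1)] this[OF assms(2)] show ?thesis by linarith
  qed
  then have "mk (CX M d) LM \<phi> \<psi> \<le> ereal (2 * D)"
    by (rule mk_le[OF assms])
  then show ?thesis by (rule order_le_less_trans) simp
qed

text \<open>\<open>real_of_ereal\<close> sends infinity to 0, so it is finiteness of
  \<open>mk\<close> that makes \<open>mkd\<close> a faithful real version of it.\<close>

lemma ereal_mkd:
  assumes "\<phi> \<in> states (CX M d)" "\<psi> \<in> states (CX M d)"
  shows "ereal (mkd \<phi> \<psi>) = mk (CX M d) LM \<phi> \<psi>"
  using mk_finite[OF assms] mk_nonneg[of \<phi> \<psi>] by (intro ereal_real') auto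

lemma mkd_le:
  assumes "\<phi> \<in> states (CX M d)" "\<psi> \<in> states (CX M d)"
    and "\<And>g. lip 1 g \<Longrightarrow> \<bar>expect \<phi> g - expect \<psi> g\<bar> \<le> r"
  shows "mkd \<phi> \<psi> \<le> r"
  using mk_le[OF assms] ereal_mkd[OF assms(1,2)] by (metis ereal_less_eq(3))

lemma expect_diff_le_mkd:
  assumes "\<phi> \<in> states (CX M d)" "\<psi> \<in> states (CX M d)" "lip 1 g"
  shows "\<bar>expect \<phi> g - expect \<psi> g\<bar> \<le> mkd \<phi> \<psi>"
proof -
  have "ereal (cmod (\<phi> (emb g) - \<psi> (emb g))) \<le> mk (CX M d) LM \<phi> \<psi>"
    unfolding mk_eq by (rule SUP_upper) (use assms(3) in blast)
  then show ?thesis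
    using ereal_mkd[OF assms(1,2)] cmod_state_diff[OF assms(1,2) lip_imp_cont[OF assms(3)]]
    by (metis ereal_less_eq(3))
qed

text \<open>The metric controls Lipschitz functions only, so \<open>g\<close> is replaced by an
  \<open>L\<close>-Lipschitz \<open>h\<close> within \<open>e/4\<close>. As \<open>h / L\<close> is
  1-Lipschitz, the radius \<open>e / (4 * L)\<close> keeps the values on \<open>h\<close> within
  \<open>e/4\<close>, and three errors of \<open>e/4\<close> stay below \<open>e\<close>.\<close>

lemma expect_mkd_continuous:
  assumes "cont g" "0 < e"
  obtains r where "0 < r" "\<And>\<phi> \<psi>. \<phi> \<in> states (CX M d) \<Longrightarrow> \<psi> \<in> states (CX M d) \<Longrightarrow> mkd \<phi> \<psi> < r \<Longrightarrow>
     \<bar>expect \<phi> g - expect \<psi> g\<bar> < e"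
proof -
  obtain L h where h: "0 < L" "lip L h" "\<And>x. x \<in> M \<Longrightarrow> \<bar>g x - h x\<bar> \<le> e/4"
    using lip_dense[OF assms(1), of "e/4"] assms(2) by auto
  have hc: "cont h" by (rule lip_imp_cont[OF h(2)])
  have "lip 1 (\<lambda>x. (1/L) * h x)"
    using h by (simp add: field_simps flip: diff_divide_distrib)
  note h1 = expect_diff_le_mkd[OF _ _ this]
  have close: "\<bar>expect \<phi> g - expect \<phi> h\<bar> \<le> e/4" if "\<phi> \<in> states (CX M d)" for \<phi>
    using expect_abs_le[OF that continuous_map_diff[OF assms(1) hc] h(3)]
      expect_diff[OF that assms(1) hc] by simp
  have "\<bar>expect \<phi> g - expect \<psi> g\<bar> < e"
    if s: "\<phi> \<in> states (CX M d)" "\<psi> \<in> states (CX M d)" and r: "mkd \<phi> \<psi> < e / (4 * L)" for \<phi> \<psi>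
  proof -
    have "\<bar>(1/L) * expect \<phi> h - (1/L) * expect \<psi> h\<bar> \<le> mkd \<phi> \<psi>"
      using h1[OF s] expect_scale[OF s(1) hc, of "1/L"] expect_scale[OF s(2) hc, of "1/L"]
      by (metis Re_complex_of_real mult.commute scaleR_complex.sel(1) scaleR_conv_of_real)
    then have "\<bar>expect \<phi> h - expect \<psi> h\<bar> \<le> L * mkd \<phi> \<psi>"
      using h(1) by (simp add: field_simps flip: diff_divide_distrib)
    also have "\<dots> < e/4"
      using r h(1) by (simp add: field_simps)
    finally show ?thesis
      using close[OF s(1)] close[OF s(2)] assms(2) by linarith
  qed
  then show ?thesis
    using that[of "e / (4 * L)"] h(1) assms(2) by simp
qed

lemma state_mkd_continuous:
  assumes "a \<in> CM" "0 < e"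
  obtains r where "0 < r" "\<And>\<phi> \<psi>. \<phi> \<in> states (CX M d) \<Longrightarrow> \<psi> \<in> states (CX M d) \<Longrightarrow> mkd \<phi> \<psi> < r \<Longrightarrow>
     cmod (\<phi> a - \<psi> a) < e"
proof -
  note c = CM_decompose[OF assms(1)]
  obtain r1 where r1: "0 < r1" "\<And>\<phi> \<psi>. \<phi> \<in> states (CX M d) \<Longrightarrow> \<psi> \<in> states (CX M d) \<Longrightarrow> mkd \<phi> \<psi> < r1 \<Longrightarrow>
     \<bar>expect \<phi> (\<lambda>x. Re (a x)) - expect \<psi> (\<lambda>x. Re (a x))\<bar> < e/2"
    using expect_mkd_continuous[OF c(1), of "e/2"] assms(2) by (metis half_gt_zero)
  obtain r2 where r2: "0 < r2" "\<And>\<phi> \<psi>. \<phi> \<in> states (CX M d) \<Longrightarrow> \<psi> \<in> states (CX M d) \<Longrightarrow> mkd \<phi> \<psi> < r2 \<Longrightarrow>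
     \<bar>expect \<phi> (\<lambda>x. Im (a x)) - expect \<psi> (\<lambda>x. Im (a x))\<bar> < e/2"
    using expect_mkd_continuous[OF c(2), of "e/2"] assms(2) by (metis half_gt_zero)
  show ?thesis
  proof (rule that[of "min r1 r2"])
    fix \<phi> \<psi> assume s: "\<phi> \<in> states (CX M d)" "\<psi> \<in> states (CX M d)" "mkd \<phi> \<psi> < min r1 r2"
    have "cmod (\<phi> a - \<psi> a) \<le> \<bar>Re (\<phi> a - \<psi> a)\<bar> + \<bar>Im (\<phi> a - \<psi> a)\<bar>"
      by (rule cmod_le)
    also have "\<dots> < e"
      using r1(2)[OF s(1,2)] r2(2)[OF s(1,2)] s(3)
      unfolding state_decompose[OF s(1) assms(1)] state_decompose[OF s(2) assms(1)] by simp
    finally show "cmod (\<phi> a - \<psi> a) < e" .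
  qed (use r1 r2 in auto)
qed

section \<open>C(M) is a Leibniz quantum compact metric space\<close>

lemma LipX_finiteE:
  assumes "LM a < \<infinity>" obtains r where "LM a = ereal r" "0 \<le> r"
  using assms LipX_nonneg[of a] by (cases "LM a") auto

lemma LipX_emb_eqD: "LM (emb g) = ereal r \<Longrightarrow> lip r g"
  using LipX_emb_le_iff[of g r] by simp

lemma LipX_add_le:
  assumes "LM (emb f) < \<infinity>" "LM (emb g) < \<infinity>"
  shows "LM (emb (\<lambda>x. f x + g x)) \<le> LM (emb f) + LM (emb g)"
proof -
  obtain r s where rs: "LM (emb f) = ereal r" "0 \<le> r" "LM (emb g) = ereal s" "0 \<le> s"
    using assms LipX_finiteE by metis
  have "lip (r + s) (\<lambda>x. f x + g x)"
  proof (intro ballI)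
    fix x y assume "x \<in> M" "y \<in> M"
    then have "\<bar>f x - f y\<bar> \<le> r * d x y" "\<bar>g x - g y\<bar> \<le> s * d x y"
      using LipX_emb_eqD rs by blast+
    then show "\<bar>f x + g x - (f y + g y)\<bar> \<le> (r + s) * d x y"
      by (simp add: algebra_simps abs_le_iff)
  qed
  then show ?thesis
    using rs LipX_emb_le_iff[of _ "r + s"] by simp
qed

text \<open>The inequality for the factor \<open>c\<close> is combined with the one for
  \<open>1/c\<close> applied to the scaled function; \<open>c = 0\<close> is treated apart.\<close>

lemma LipX_scale:
  assumes "LM (emb f) < \<infinity>"
  shows "LM (emb (\<lambda>x. c * f x)) = ereal \<bar>c\<bar> * LM (emb f)"
proof -
  have le: "LM (emb (\<lambda>x. c * f x)) \<le> ereal (\<bar>c\<bar> * r)" if "LM (emb f) = ereal r" "0 \<le> r" for c f r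
    using LipX_emb_eqD[OF that(1)] that(2)
    by (auto simp: LipX_emb_le_iff abs_mult mult.assoc mult_left_mono simp flip: right_diff_distrib)
  obtain r where r: "LM (emb f) = ereal r" "0 \<le> r"
    using assms LipX_finiteE by metis
  note le1 = le[OF r, of c]
  then have "LM (emb (\<lambda>x. c * f x)) < \<infinity>"
    by (rule order_le_less_trans) simp
  then obtain t where t: "LM (emb (\<lambda>x. c * f x)) = ereal t" "0 \<le> t"
    using LipX_finiteE by metis
  have "\<bar>c\<bar> * r \<le> t"
  proof (cases "c = 0")
    case False
    then show ?thesis
      using le[OF t, of "1/c"] r by (simp add: field_simps)
  qed (use t in simp)
  then show ?thesis using le1 r t by simp
qed

lemma LipX_emb_0_iff: "LM (emb g) = 0 \<longleftrightarrow> (\<exists>c. \<forall>x\<in>M. g x = c)"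
proof -
  have "LM (emb g) = 0 \<longleftrightarrow> LM (emb g) \<le> ereal 0"
    using LipX_nonneg[of "emb g"] by (auto simp: zero_ereal_def)
  also have "\<dots> \<longleftrightarrow> (\<exists>c. \<forall>x\<in>M. g x = c)"
  proof
    assume "LM (emb g) \<le> ereal 0"
    then have g: "lip 0 g" unfolding LipX_emb_le_iff by blast
    obtain x0 where "x0 \<in> M" using M_ne by blast
    then have "\<bar>g x - g x0\<bar> \<le> 0 * d x x0" if "x \<in> M" for x
      using g that by blast
    then have "\<forall>x\<in>M. g x = g x0" by simp
    then show "\<exists>c. \<forall>x\<in>M. g x = c" by blast
  qed (auto simp: LipX_emb_le_iff)
  finally show ?thesis .
qed

lemma cdist_emb:
  assumes "cont f" "cont g"
  shows "x \<in> M \<Longrightarrow> \<bar>f x - g x\<bar> \<le> cdist (CX M d) (emb f) (emb g)"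
    and "(\<And>x. x \<in> M \<Longrightarrow> \<bar>f x - g x\<bar> \<le> B) \<Longrightarrow> cdist (CX M d) (emb f) (emb g) \<le> B"
  using norm_diff_le_cdist[OF emb_in_CM[OF assms(1)] emb_in_CM[OF assms(2)], of x]
    cdist_le[of "emb f" "emb g" B]
  by (simp_all add: CX_eq flip: of_real_diff)

text \<open>For separation, distance 0 forces equal values on all of C(M) by
  \<open>state_mkd_continuous\<close>. Off the carrier both functionals are 0 by the convention in
  \<open>states\<close>, so they are equal as functions.\<close>

lemma mkd_Metric_space: "Metric_space (states (CX M d)) mkd"
proof
  fix \<phi> \<psi> show "0 \<le> mkd \<phi> \<psi>" using mk_nonneg by (rule real_of_ereal_pos)
  show "mkd \<phi> \<psi> = mkd \<psi> \<phi>" by (simp add: mk_commute)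
  assume s: "\<phi> \<in> states (CX M d)" "\<psi> \<in> states (CX M d)"
  show "mkd \<phi> \<psi> = 0 \<longleftrightarrow> \<phi> = \<psi>"
  proof
    assume 0: "mkd \<phi> \<psi> = 0"
    show "\<phi> = \<psi>"
    proof
      fix a show "\<phi> a = \<psi> a"
      proof (cases "a \<in> CM")
        case True
        have "cmod (\<phi> a - \<psi> a) < e" if "0 < e" for e
          using state_mkd_continuous[OF True that] 0 s by metis
        then show ?thesis
          using field_lbound_gt_zero by (metis less_irrefl zero_less_norm_iff right_minus_eq)
      qed (use state_linear(4) s in metis)
    qed
  qed (simp add: mk_refl)
  fix \<rho> assume \<rho>: "\<rho> \<in> states (CX M d)"
  show "mkd \<phi> \<rho> \<le> mkd \<phi> \<psi> + mkd \<psi> \<rho>"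
  proof (rule mkd_le[OF s(1) \<rho>])
    fix g assume "lip 1 g"
    from expect_diff_le_mkd[OF s this] expect_diff_le_mkd[OF s(2) \<rho> this]
    show "\<bar>expect \<phi> g - expect \<rho> g\<bar> \<le> mkd \<phi> \<psi> + mkd \<psi> \<rho>" by linarith
  qed
qed

text \<open>This is continuity of the identity into the weak* topology, which may be tested on
  generating sets. Each of these constrains a single value \<open>\<phi> a\<close>, and
  \<open>state_mkd_continuous\<close> provides the radius.\<close>

lemma weakstar_open_in_mkd:
  assumes "openin (weakstar (CX M d)) T"
  shows "openin (Metric_space.mtopology (states (CX M d)) mkd) (T \<inter> states (CX M d))"
proof -
  interpret MK: Metric_space "states (CX M d)" mkd by (rule mkd_Metric_space)
  have "continuous_map MK.mtopology (weakstar (CX M d)) (\<lambda>\<phi>. \<phi>)"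
    unfolding weakstar_def
  proof (rule continuous_on_generated_topo)
    fix W :: "(('a \<Rightarrow> complex) \<Rightarrow> complex) set"
    assume "W \<in> {{\<phi>. \<phi> a \<in> U} | a U. a \<in> cset (CX M d) \<and> open U}"
    then obtain a U where W: "W = {\<phi>. \<phi> a \<in> U}" "a \<in> CM" "open U"
      unfolding CX_sel by blast
    have "\<exists>r>0. MK.mball \<phi> r \<subseteq> W \<inter> states (CX M d)" if \<phi>: "\<phi> \<in> W \<inter> states (CX M d)" for \<phi>
    proof -
      obtain e where e: "0 < e" "ball (\<phi> a) e \<subseteq> U"
        using \<phi> W open_contains_ball by blast
      obtain r where r: "0 < r" "\<And>\<phi> \<psi>. \<phi> \<in> states (CX M d) \<Longrightarrow> \<psi> \<in> states (CX M d) \<Longrightarrow> mkd \<phi> \<psi> < r \<Longrightarrow>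
          cmod (\<phi> a - \<psi> a) < e"
        using state_mkd_continuous[OF W(2) e(1)] by blast
      have "MK.mball \<phi> r \<subseteq> W \<inter> states (CX M d)"
      proof
        fix \<psi> assume "\<psi> \<in> MK.mball \<phi> r"
        then have "\<psi> \<in> states (CX M d)" "cmod (\<phi> a - \<psi> a) < e"
          using r(2) by (auto simp: MK.in_mball)
        then show "\<psi> \<in> W \<inter> states (CX M d)"
          using e(2) W(1) by (auto simp: dist_norm)
      qed
      with r(1) show ?thesis by blast
    qed
    then show "openin MK.mtopology ((\<lambda>\<phi>. \<phi>) -` W \<inter> topspace MK.mtopology)"
      unfolding MK.openin_mtopology by auto
  next
    \<comment> \<open>\<open>continuous_on_generated_topo\<close> also asks that the generating sets
      cover the image; \<open>U = UNIV\<close> provides the whole space.\<close>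
    have "(UNIV :: (('a \<Rightarrow> complex) \<Rightarrow> complex) set) \<in> {{\<phi>. \<phi> a \<in> U} | a U. a \<in> cset (CX M d) \<and> open U}"
      using const[of 0] unfolding CX_sel
      by (intro CollectI exI[of _ "restrict (\<lambda>x. 0) M"] exI[of _ UNIV]) auto
    then show "(\<lambda>\<phi>. \<phi>) ` topspace MK.mtopology \<subseteq> \<Union> {{\<phi>. \<phi> a \<in> U} | a U. a \<in> cset (CX M d) \<and> open U}"
      by blast
  qed
  from openin_continuous_map_preimage[OF this assms] show ?thesis
    by (simp add: Int_def conj_commute)
qed

text \<open>The finitely many values on a partition of unity determine a state on all 1-Lipschitz
  functions at once, up to a small error. A weak* condition on these values therefore
  suffices.\<close>

lemma weakstar_neighbourhood_in_mkd_ball: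
  assumes \<phi>: "\<phi> \<in> states (CX M d)" and "0 < r"
  obtains T where "openin (weakstar (CX M d)) T" "\<phi> \<in> T"
    "\<And>\<psi>. \<psi> \<in> T \<Longrightarrow> \<psi> \<in> states (CX M d) \<Longrightarrow> mkd \<phi> \<psi> < r"
proof -
  obtain D where D: "0 < D" "\<And>x y. x \<in> M \<Longrightarrow> y \<in> M \<Longrightarrow> d x y \<le> D"
    using bounded_metric by blast
  obtain x0 where x0: "x0 \<in> M" using M_ne by blast
  have "\<exists>s\<in>M. d x s < r / 4" if "x \<in> M" for x
    using that \<open>0 < r\<close> by (intro bexI[of _ x]) auto
  then obtain K p where p: "subordinate_partition (r/4) K p"
    using subordinate_partition_exists[of "r/4" M] \<open>0 < r\<close>
    by (metis divide_pos_pos order_refl zero_less_numeral)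
  have K: "finite K" "K \<subseteq> M" "\<And>k. k \<in> K \<Longrightarrow> cont (p k)"
    using p by (auto simp: subordinate_partition_def)
  have "K \<noteq> {}"
    using expect_partition(2)[OF \<phi> p] by auto
  then have cK: "0 < real (card K)" using K by (simp add: card_gt_0_iff)
  \<comment> \<open>There are \<open>card K\<close> terms, each at most \<open>D * \<eta>\<close>,
    which add up to \<open>r/4\<close>. With two approximation errors of \<open>r/4\<close> the
    total is \<open>3 * r / 4\<close>.\<close>
  define \<eta> where "\<eta> = r / (4 * D * card K)"
  have \<eta>: "0 < \<eta>" using D cK \<open>0 < r\<close> by (simp add: \<eta>_def)
  define T where "T = (\<Inter>k\<in>K. {\<psi>. \<psi> (emb (p k)) \<in> ball (\<phi> (emb (p k))) \<eta>})"
  show ?thesis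
  proof (rule that[of T])
    show "\<phi> \<in> T" using \<eta> by (simp add: T_def)
    show "openin (weakstar (CX M d)) T"
      unfolding T_def
    proof (rule openin_Inter)
      fix W assume "W \<in> (\<lambda>k. {\<psi>. \<psi> (emb (p k)) \<in> ball (\<phi> (emb (p k))) \<eta>}) ` K"
      then obtain k where k: "k \<in> K" "W = {\<psi>. \<psi> (emb (p k)) \<in> ball (\<phi> (emb (p k))) \<eta>}" by blast
      then have "emb (p k) \<in> cset (CX M d)"
        unfolding CX_sel using emb_in_CM K by blast
      then show "openin (weakstar (CX M d)) W"
        unfolding weakstar_def k(2) by (intro topology_generated_by_Basis) blast
    qed (use K \<open>K \<noteq> {}\<close> in auto)
  next
    fix \<psi> assume T: "\<psi> \<in> T" and \<psi>: "\<psi> \<in> states (CX M d)"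
    have "mkd \<phi> \<psi> \<le> 3 * r / 4"
    proof (rule mkd_le[OF \<phi> \<psi>])
      fix g assume g: "lip 1 g"
      \<comment> \<open>Both families of weights sum to 1, so the constant \<open>g x0\<close> can
        be subtracted; this gives a bound \<open>D\<close> on the coefficients that is uniform in
        \<open>g\<close>.\<close>
      have "(\<Sum>k\<in>K. g k * expect \<phi> (p k)) - (\<Sum>k\<in>K. g k * expect \<psi> (p k))
          = (\<Sum>k\<in>K. (g k - g x0) * (expect \<phi> (p k) - expect \<psi> (p k)))"
        using expect_partition(2)[OF \<phi> p] expect_partition(2)[OF \<psi> p]
        by (simp add: algebra_simps sum_subtractf sum.distrib flip: sum_distrib_left)
      also have "\<bar>\<dots>\<bar> \<le> (\<Sum>k\<in>K. D * \<eta>)"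
      proof (rule order_trans[OF sum_abs sum_mono])
        fix k assume k: "k \<in> K"
        then have "\<psi> (emb (p k)) \<in> ball (\<phi> (emb (p k))) \<eta>"
          using T by (auto simp: T_def)
        then have "\<bar>expect \<phi> (p k) - expect \<psi> (p k)\<bar> \<le> \<eta>"
          using cmod_state_diff[OF \<phi> \<psi> K(3)[OF k]] by (simp add: dist_norm)
        moreover have "\<bar>g k - g x0\<bar> \<le> D"
          using g x0 k K D(2)[of k x0] by (metis mult_1 order_trans subsetD)
        ultimately show "\<bar>(g k - g x0) * (expect \<phi> (p k) - expect \<psi> (p k))\<bar> \<le> D * \<eta>"
          using D by (simp add: abs_mult mult_mono)
      qed
      also have "\<dots> = r / 4"
        using cK D by (simp add: \<eta>_def)
      finally show "\<bar>expect \<phi> g - expect \<psi> g\<bar> \<le> 3 * r / 4"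
        using expect_partition_approx[OF \<phi> p g] expect_partition_approx[OF \<psi> p g] by linarith
    qed
    then show "mkd \<phi> \<psi> < r" using \<open>0 < r\<close> by linarith
  qed
qed

lemma mkd_topology:
  "Metric_space.mtopology (states (CX M d)) mkd = subtopology (weakstar (CX M d)) (states (CX M d))"
proof -
  interpret MK: Metric_space "states (CX M d)" mkd by (rule mkd_Metric_space)
  show ?thesis
    unfolding topology_eq
  proof (intro allI iffI)
    fix U assume U: "openin MK.mtopology U"
    show "openin (subtopology (weakstar (CX M d)) (states (CX M d))) U"
    proof (subst openin_subopen, intro ballI)
      fix \<phi> assume "\<phi> \<in> U"
      then obtain r where r: "0 < r" "MK.mball \<phi> r \<subseteq> U" and \<phi>: "\<phi> \<in> states (CX M d)"
        using U unfolding MK.openin_mtopology by blast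
      obtain T where T: "openin (weakstar (CX M d)) T" "\<phi> \<in> T"
        "\<And>\<psi>. \<psi> \<in> T \<Longrightarrow> \<psi> \<in> states (CX M d) \<Longrightarrow> mkd \<phi> \<psi> < r"
        using weakstar_neighbourhood_in_mkd_ball[OF \<phi> r(1)] by blast
      have "T \<inter> states (CX M d) \<subseteq> MK.mball \<phi> r"
        using T(3) \<phi> by (auto simp: MK.in_mball)
      then show "\<exists>V. openin (subtopology (weakstar (CX M d)) (states (CX M d))) V \<and> \<phi> \<in> V \<and> V \<subseteq> U"
        using T r \<phi> by (intro exI[of _ "T \<inter> states (CX M d)"]) (auto simp: openin_subtopology)
    qed
  next
    fix U assume "openin (subtopology (weakstar (CX M d)) (states (CX M d))) U"
    then show "openin MK.mtopology U"
      using weakstar_open_in_mkd by (auto simp: openin_subtopology)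
  qed
qed

lemma CX_ops_emb:
  "cadd (CX M d) (emb f) (emb g) = emb (\<lambda>x. f x + g x)"
  "csmul (CX M d) (complex_of_real c) (emb f) = emb (\<lambda>x. c * f x)"
  "csmul (CX M d) (1/2) (cadd (CX M d) (cmul (CX M d) (emb f) (emb g)) (cmul (CX M d) (emb g) (emb f)))
     = emb (\<lambda>x. f x * g x)"
  "csmul (CX M d) (1/(2*\<i>)) (cadd (CX M d) (cmul (CX M d) (emb f) (emb g))
     (cneg (CX M d) (cmul (CX M d) (emb g) (emb f)))) = emb (\<lambda>x. 0)"
  "csmul (CX M d) (complex_of_real c) (cone (CX M d)) = emb (\<lambda>x. c)"
  by (auto simp: CX_sel emb_def fun_eq_iff restrict_def)

lemma qcms_CX: "qcms (CX M d) LM"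
proof -
  have 1: "LM (cadd (CX M d) a b) \<le> LM a + LM b"
    if "a \<in> sa (CX M d)" "b \<in> sa (CX M d)" "LM a < \<infinity>" "LM b < \<infinity>" for a b
    using that LipX_add_le unfolding sa_CX by (auto simp: CX_ops_emb)
  have 2: "LM (csmul (CX M d) (complex_of_real r) a) = ereal \<bar>r\<bar> * LM a"
    if "a \<in> sa (CX M d)" "LM a < \<infinity>" for a r
    using that LipX_scale unfolding sa_CX by (auto simp: CX_ops_emb)
  have 3: "\<exists>b\<in>sa (CX M d). LM b < \<infinity> \<and> cdist (CX M d) a b < e"
    if a: "a \<in> sa (CX M d)" and "0 < e" for a e
  proof -
    obtain g where g: "cont g" "a = emb g" using a unfolding sa_CX by blast
    obtain L h where h: "0 < L" "lip L h" "\<And>x. x \<in> M \<Longrightarrow> \<bar>g x - h x\<bar> \<le> e/2"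
      using lip_dense[OF g(1) half_gt_zero[OF \<open>0 < e\<close>]] by blast
    have hc: "cont h" by (rule lip_imp_cont[OF h(2)])
    have "LM (emb h) \<le> ereal L"
      unfolding LipX_emb_le_iff using h(1,2) by (intro conjI) linarith+
    then have "LM (emb h) < \<infinity>" by (rule order_le_less_trans) simp
    moreover have "cdist (CX M d) a (emb h) < e"
      using cdist_emb(2)[OF g(1) hc h(3)] \<open>0 < e\<close> g(2) by simp
    moreover have "emb h \<in> sa (CX M d)" unfolding sa_CX using hc by blast
    ultimately show ?thesis by blast
  qed
  have 4: "LM a = 0 \<longleftrightarrow> a \<in> real_units (CX M d)" if a: "a \<in> sa (CX M d)" for a
  proof -
    obtain g where g: "a = emb g" using a unfolding sa_CX by blast
    have "emb g = emb (\<lambda>x. c) \<longleftrightarrow> (\<forall>x\<in>M. g x = c)" for c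
      by (auto simp: emb_def fun_eq_iff restrict_def)
    then show ?thesis
      unfolding real_units_def g CX_ops_emb LipX_emb_0_iff by auto
  qed
  show ?thesis
    unfolding qcms_def
    using 1 2 3 4 mk_finite mkd_Metric_space mkd_topology LipX_nonneg LipX_finite_imp_real
      unital_cstar_alg_fun_cstar
    by (simp add: CX_sel(1) flip: CX_eq)
qed

text \<open>Norm convergence implies pointwise convergence, so each difference quotient of the limit
  is a limit of quotients bounded by \<open>r\<close>.\<close>

lemma LipX_lower_semicontinuous:
  assumes "\<And>n. s n \<in> sa (CX M d)" "\<And>n. LM (s n) \<le> r" "a \<in> sa (CX M d)"
    and lim: "(\<lambda>n::nat. cdist (CX M d) (s n) a) \<longlonglongrightarrow> 0"
  shows "LM a \<le> r"
proof -
  obtain h where h: "cont h" "a = emb h" using assms(3) unfolding sa_CX by blast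
  have "\<forall>n. \<exists>g. cont g \<and> s n = emb g" using assms(1) unfolding sa_CX by blast
  then obtain g where g: "\<And>n. cont (g n)" "\<And>n. s n = emb (g n)" by metis
  have gh: "(\<lambda>n. g n x) \<longlonglongrightarrow> h x" if "x \<in> M" for x
    using cdist_emb(1)[OF g(1) h(1) that] lim unfolding g(2) h(2)
    by (intro LIM_zero_cancel[of _ "h x"] Lim_null_comparison[OF _ lim[unfolded g(2) h(2)]]) auto
  have "ereal (\<bar>h x - h y\<bar> / d x y) \<le> r" if xy: "x \<in> M" "y \<in> M" "x \<noteq> y" for x y
  proof (rule LIMSEQ_le_const2)
    show "(\<lambda>n. ereal (\<bar>g n x - g n y\<bar> / d x y)) \<longlonglongrightarrow> ereal (\<bar>h x - h y\<bar> / d x y)"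
      using xy by (intro tendsto_intros gh) auto
    show "\<exists>N. \<forall>n\<ge>N. ereal (\<bar>g n x - g n y\<bar> / d x y) \<le> r"
      using assms(2) xy unfolding g(2) LipX_emb_le_iff' by blast
  qed
  moreover have "0 \<le> r" using assms(2)[of 0] LipX_nonneg order_trans by blast
  ultimately show ?thesis
    unfolding h(2) LipX_emb_le_iff' by blast
qed

text \<open>The identity behind the product rule is applied to each difference quotient, before any
  supremum is formed. The estimate runs in the extended reals, so infinite seminorms need no
  separate case.\<close>

lemma LipX_mult_le:
  assumes "cont f" "cont g"
  shows "LM (emb (\<lambda>x. f x * g x))
    \<le> ereal (cnrm (CX M d) (emb f)) * LM (emb g) + ereal (cnrm (CX M d) (emb g)) * LM (emb f)"
    (is "_ \<le> ?R")
  unfolding LipX_emb_le_iff'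
proof (intro conjI ballI impI)
  have nrm: "\<bar>f x\<bar> \<le> cnrm (CX M d) (emb f)" if "cont f" "x \<in> M" for f x
    using norm_le_sup_norm[OF emb_in_CM[OF that(1)] that(2)] that(2) by (simp add: CX_sel)
  have quot: "ereal (\<bar>f x - f y\<bar> / d x y) \<le> LM (emb f)" if "x \<in> M" "y \<in> M" "x \<noteq> y" for f x y
    using LipX_emb_le_iff'[of f "LM (emb f)"] that by blast
  have nrm0: "0 \<le> cnrm (CX M d) (emb f)" if "cont f" for f
    using sup_norm_nonneg[OF emb_in_CM[OF that]] by (simp add: CX_sel)
  show "0 \<le> ?R"
    using nrm0 assms LipX_nonneg by (intro add_nonneg_nonneg ereal_0_le_mult) auto
  fix x y assume xy: "x \<in> M" "y \<in> M" "x \<noteq> y"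
  have "\<bar>f x * g x - f y * g y\<bar> = \<bar>f x * (g x - g y) + g y * (f x - f y)\<bar>"
    by (simp add: algebra_simps)
  also have "\<dots> \<le> \<bar>f x\<bar> * \<bar>g x - g y\<bar> + \<bar>g y\<bar> * \<bar>f x - f y\<bar>"
    by (metis abs_mult abs_triangle_ineq)
  finally have "\<bar>f x * g x - f y * g y\<bar> / d x y
      \<le> (\<bar>f x\<bar> * \<bar>g x - g y\<bar> + \<bar>g y\<bar> * \<bar>f x - f y\<bar>) / d x y"
    by (rule divide_right_mono) simp
  then have "ereal (\<bar>f x * g x - f y * g y\<bar> / d x y)
      \<le> ereal \<bar>f x\<bar> * ereal (\<bar>g x - g y\<bar> / d x y) + ereal \<bar>g y\<bar> * ereal (\<bar>f x - f y\<bar> / d x y)"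
    by (simp add: add_divide_distrib)
  also have "\<dots> \<le> ?R"
    using xy nrm nrm0 quot assms LipX_nonneg
    by (intro add_mono ereal_mult_mono) auto
  finally show "ereal (\<bar>f x * g x - f y * g y\<bar> / d x y) \<le> ?R" .
qed

text \<open>By commutativity the Jordan product is the pointwise product and the Lie product is 0.
  The Lie inequality thus reduces to nonnegativity of its right-hand side.\<close>

lemma leibniz_qcms_CX: "leibniz_qcms (CX M d) LM"
proof -
  have "0 \<le> ereal (cnrm (CX M d) (emb f)) * LM (emb g) + ereal (cnrm (CX M d) (emb g)) * LM (emb f)"
    if "cont f" "cont g" for f g
    using LipX_mult_le[OF that] LipX_nonneg order_trans by blast
  moreover have "LM (emb (\<lambda>x. 0)) = 0"
    using LipX_emb_0_iff by blast
  ultimately have "LM (csmul (CX M d) (1/2) (cadd (CX M d) (cmul (CX M d) a b) (cmul (CX M d) b a)))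
          \<le> ereal (cnrm (CX M d) a) * LM b + ereal (cnrm (CX M d) b) * LM a \<and>
        LM (csmul (CX M d) (1/(2*\<i>)) (cadd (CX M d) (cmul (CX M d) a b) (cneg (CX M d) (cmul (CX M d) b a))))
          \<le> ereal (cnrm (CX M d) a) * LM b + ereal (cnrm (CX M d) b) * LM a"
    if "a \<in> sa (CX M d)" "b \<in> sa (CX M d)" for a b
    using that LipX_mult_le unfolding sa_CX by (auto simp only: CX_ops_emb)
  then show ?thesis
    unfolding leibniz_qcms_def using qcms_CX LipX_lower_semicontinuous by blast
qed

end

section \<open>Bounded sequences as a bridge algebra\<close>

text \<open>With index set \<open>UNIV\<close>, extensionality is vacuous and
  \<open>restrict\<close> is the identity, so the operations are the plain pointwise ones.\<close>

abbreviation linf :: "(nat \<Rightarrow> complex) cstar" where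
  "linf \<equiv> fun_cstar UNIV {f. bounded (range f)}"

interpretation linf: fun_algebra UNIV "{f :: nat \<Rightarrow> complex. bounded (range f)}"
proof
  fix f g :: "nat \<Rightarrow> complex" assume f: "f \<in> {f. bounded (range f)}"
  then obtain B where B: "\<And>n. cmod (f n) \<le> B"
    by (auto simp: bounded_iff)
  then show "bdd_above (range (\<lambda>n. cmod (f n)))"
    by (intro bdd_aboveI2)
  show "restrict (\<lambda>x. cnj (f x)) UNIV \<in> {f. bounded (range f)}"
    using B by (auto simp: bounded_iff)
  assume "g \<in> {f. bounded (range f)}"
  then obtain C where C: "\<And>n. cmod (g n) \<le> C"
    by (auto simp: bounded_iff)
  show "restrict (\<lambda>x. f x + g x) UNIV \<in> {f. bounded (range f)}"
    using B C by (auto simp: bounded_iff intro!: exI[of _ "B + C"] norm_triangle_le add_mono)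
  show "restrict (\<lambda>x. f x * g x) UNIV \<in> {f. bounded (range f)}"
    using B C order_trans[OF norm_ge_zero B]
    by (auto simp: bounded_iff norm_mult intro!: exI[of _ "B * C"] mult_mono)
next
  fix s :: "nat \<Rightarrow> nat \<Rightarrow> complex" and l
  assume s: "\<And>n. s n \<in> {f. bounded (range f)}" and u: "uniform_limit UNIV s l sequentially"
  \<comment> \<open>A single term within distance 1 of the limit bounds the limit by
    \<open>B + 1\<close>.\<close>
  obtain N where N: "\<And>n. dist (s N n) (l n) < 1"
    using uniform_limitD[OF u, of 1] unfolding eventually_sequentially by auto
  obtain B where B: "\<And>n. cmod (s N n) \<le> B"
    using s[of N] by (auto simp: bounded_iff)
  have "cmod (l n) \<le> B + 1" for n
    using N[of n] B[of n] norm_triangle_sub[of "l n" "s N n"] by (simp add: dist_norm norm_minus_commute)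
  then show "l \<in> {f. bounded (range f)}"
    by (auto simp: bounded_iff)
qed auto

lemma linf_sel:
  "cset linf = {f. bounded (range f)}"
  "czero linf = (\<lambda>n. 0)"
  "cone linf = (\<lambda>n. 1)"
  "cadd linf f g = (\<lambda>n. f n + g n)"
  "cneg linf f = (\<lambda>n. - f n)"
  "csmul linf c f = (\<lambda>n. c * f n)"
  "cmul linf f g = (\<lambda>n. f n * g n)"
  "cstr linf f = (\<lambda>n. cnj (f n))"
  by (simp_all add: fun_cstar_def restrict_def)

lemma unital_cstar_alg_closed:
  assumes "unital_cstar_alg A"
  shows "czero A \<in> cset A" "cone A \<in> cset A"
    and "a \<in> cset A \<Longrightarrow> b \<in> cset A \<Longrightarrow> cadd A a b \<in> cset A"
    and "a \<in> cset A \<Longrightarrow> b \<in> cset A \<Longrightarrow> cmul A a b \<in> cset A"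
    and "a \<in> cset A \<Longrightarrow> cneg A a \<in> cset A"
    and "a \<in> cset A \<Longrightarrow> cstr A a \<in> cset A"
    and "a \<in> cset A \<Longrightarrow> csmul A c a \<in> cset A"
proof -
  have "\<forall>a\<in>cset A. \<forall>b\<in>cset A. cadd A a b \<in> cset A \<and> cmul A a b \<in> cset A"
    "\<forall>a\<in>cset A. cneg A a \<in> cset A \<and> cstr A a \<in> cset A \<and> (\<forall>c. csmul A c a \<in> cset A)"
    using assms unfolding unital_cstar_alg_def by - (elim conjE, assumption)+
  then show "a \<in> cset A \<Longrightarrow> b \<in> cset A \<Longrightarrow> cadd A a b \<in> cset A"
    "a \<in> cset A \<Longrightarrow> b \<in> cset A \<Longrightarrow> cmul A a b \<in> cset A"
    "a \<in> cset A \<Longrightarrow> cneg A a \<in> cset A"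
    "a \<in> cset A \<Longrightarrow> cstr A a \<in> cset A"
    "a \<in> cset A \<Longrightarrow> csmul A c a \<in> cset A"
    by blast+
  show "czero A \<in> cset A" "cone A \<in> cset A"
    using assms unfolding unital_cstar_alg_def by - (elim conjE, assumption)+
qed

text \<open>A convex combination of evaluations at the indices \<open>n k\<close>; all states
  exhibited on the sequence algebra have this form. The value 0 off the carrier is the convention of
  \<open>states\<close>, and positivity holds because each evaluation sends the product of the
  adjoint of \<open>f\<close> with \<open>f\<close> to a squared modulus.\<close>

lemma convex_state:
  fixes J :: "(nat \<Rightarrow> complex) \<Rightarrow> 'u"
  assumes J: "inj J" and K: "\<And>k. k \<in> K \<Longrightarrow> 0 \<le> w k" "(\<Sum>k\<in>K. w k) = 1"
  shows "(\<lambda>u. if u \<in> cset (transport J linf) then \<Sum>k\<in>K. complex_of_real (w k) * inv J u (n k) else 0)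
    \<in> states (transport J linf)" (is "?\<omega> \<in> _")
proof -
  define \<omega> where "\<omega> = ?\<omega>"
  have \<omega>: "\<omega> (J f) = (\<Sum>k\<in>K. complex_of_real (w k) * f (n k))" if "f \<in> cset linf" for f
    using that by (simp add: \<omega>_def transport_sel[OF J] J)
  note cl = unital_cstar_alg_closed[OF linf.unital_cstar_alg_fun_cstar]
  have "\<omega> (J (cadd linf f g)) = \<omega> (J f) + \<omega> (J g)"
    if "f \<in> cset linf" "g \<in> cset linf" for f g
    unfolding \<omega>[OF that(1)] \<omega>[OF that(2)] \<omega>[OF cl(3)[OF that]]
    by (simp add: linf_sel algebra_simps sum.distrib)
  moreover have "\<omega> (J (csmul linf c f)) = c * \<omega> (J f)" if "f \<in> cset linf" for f c
    unfolding \<omega>[OF that] \<omega>[OF cl(7)[OF that]]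
    by (simp add: linf_sel algebra_simps sum_distrib_left)
  moreover have "Im (\<omega> (J (cmul linf (cstr linf f) f))) = 0 \<and> 0 \<le> Re (\<omega> (J (cmul linf (cstr linf f) f)))"
    if "f \<in> cset linf" for f
  proof -
    have "\<omega> (J (cmul linf (cstr linf f) f)) = of_real (\<Sum>k\<in>K. w k * (cmod (f (n k)))\<^sup>2)"
      unfolding \<omega>[OF cl(4)[OF cl(6)[OF that] that]] of_real_sum
      by (intro sum.cong refl) (simp add: linf_sel complex_norm_square mult.commute del: of_real_power)
    then show ?thesis
      using K(1) by (simp add: sum_nonneg del: of_real_sum)
  qed
  moreover have "\<omega> (J (cone linf)) = 1"
    unfolding \<omega>[OF cl(2)] using K(2) by (simp add: linf_sel flip: of_real_sum)
  moreover have "\<omega> u = 0" if "u \<notin> J ` cset linf" for u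
    using that by (simp add: \<omega>_def transport_sel[OF J])
  ultimately have "\<omega> \<in> states (transport J linf)"
    unfolding states_def transport_sel(1)[OF J] ball_simps(9) transport_sel[OF J] by blast
  then show ?thesis by (simp only: \<omega>_def)
qed

lemma pullback_state:
  assumes "unital_cstar_alg A" "unital_inj_star_hom A D \<pi>" "\<phi> \<in> states D"
  shows "pullback A \<pi> \<phi> \<in> states A"
proof -
  note cl = unital_cstar_alg_closed[OF assms(1)]
  have \<pi>: "\<pi> a \<in> cset D" "\<pi> (cone A) = cone D" "\<pi> (cadd A a b) = cadd D (\<pi> a) (\<pi> b)"
      "\<pi> (cmul A a b) = cmul D (\<pi> a) (\<pi> b)" "\<pi> (csmul A c a) = csmul D c (\<pi> a)"
      "\<pi> (cstr A a) = cstr D (\<pi> a)"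
    if "a \<in> cset A" "b \<in> cset A" for a b c
    using assms(2) that unfolding unital_inj_star_hom_def by blast+
  have \<phi>: "u \<in> cset D \<Longrightarrow> v \<in> cset D \<Longrightarrow> \<phi> (cadd D u v) = \<phi> u + \<phi> v"
      "u \<in> cset D \<Longrightarrow> \<phi> (csmul D c u) = c * \<phi> u"
      "u \<in> cset D \<Longrightarrow> Im (\<phi> (cmul D (cstr D u) u)) = 0 \<and> 0 \<le> Re (\<phi> (cmul D (cstr D u) u))"
      "\<phi> (cone D) = 1" for u v c
    using assms(3) unfolding states_def by blast+
  show ?thesis
    unfolding states_def pullback_def by (simp add: cl \<pi> \<pi>(2)[OF cl(2) cl(2)] \<phi>)
qed

text \<open>With pivot \<open>1\<close> the element \<open>1 - 1\<close> is 0, and both conditions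
  of \<open>one_level\<close> say that a state vanishes at 0. That products with 0 are 0 is obtained
  from submultiplicativity of the norm.\<close>

lemma one_level_cone:
  assumes "unital_cstar_alg D"
  shows "one_level D (cone D) = states D"
proof -
  note cl = unital_cstar_alg_closed[OF assms]
  have "\<forall>a\<in>cset D. cadd D (czero D) a = a \<and> cadd D a (cneg D a) = czero D"
    using assms unfolding unital_cstar_alg_def by (elim conjE)
  then have z: "cadd D (cone D) (cneg D (cone D)) = czero D" "cadd D (czero D) (czero D) = czero D"
    using cl by blast+
  have "\<forall>a\<in>cset D. cnrm D a \<ge> 0 \<and> (cnrm D a = 0 \<longleftrightarrow> a = czero D)"
    "\<forall>a\<in>cset D. \<forall>b\<in>cset D. cnrm D (cmul D a b) \<le> cnrm D a * cnrm D b"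
    using assms unfolding unital_cstar_alg_def by - (elim conjE, assumption)+
  then have zz: "cmul D a b = czero D" if "a \<in> cset D" "b \<in> cset D" "a = czero D \<or> b = czero D" for a b
    using that cl by (metis mult_zero_left mult_zero_right order_antisym)
  have "\<phi> (czero D) = 0" if "\<phi> \<in> states D" for \<phi>
  proof -
    have "\<phi> (cadd D (czero D) (czero D)) = \<phi> (czero D) + \<phi> (czero D)"
      using that cl(1) unfolding states_def by blast
    then show ?thesis unfolding z by simp
  qed
  then show ?thesis
    unfolding one_level_def z using zz cl(1) cl(6)[OF cl(1)] by auto
qed

lemma haus_le:
  assumes "\<And>s. s \<in> S \<Longrightarrow> \<exists>t\<in>T. d s t \<le> r" and "\<And>t. t \<in> T \<Longrightarrow> \<exists>s\<in>S. d s t \<le> r"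
  shows "haus d S T \<le> ereal r"
  unfolding haus_def
proof (intro max.boundedI SUP_least)
  fix s assume "s \<in> S"
  then obtain t where "t \<in> T" "d s t \<le> r" using assms(1) by blast
  then show "(INF t\<in>T. ereal (d s t)) \<le> ereal r" by (intro INF_lower2[of t]) auto
next
  fix t assume "t \<in> T"
  then obtain s where "s \<in> S" "d s t \<le> r" using assms(2) by blast
  then show "(INF s\<in>S. ereal (d s t)) \<le> ereal r" by (intro INF_lower2[of s]) auto
qed

section \<open>Dense sequences, sampling, and the height of the bridge\<close>

context compact_metric
begin

text \<open>Repetitions are allowed, so finite spaces have such sequences too and one index set can
  serve both spaces.\<close>

definition dense_seq :: "(nat \<Rightarrow> 'a) \<Rightarrow> bool" where
  "dense_seq x \<longleftrightarrow> range x \<subseteq> M \<and> (\<forall>z\<in>M. \<forall>e>0. \<exists>n. d z (x n) < e)"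

text \<open>Total boundedness gives a finite net of mesh \<open>inverse (real (Suc m))\<close> for
  each \<open>m\<close>. Their union is countable, and \<open>from_nat_into\<close> lists it, with
  repetitions if it is finite.\<close>

lemma dense_seq_exists: "\<exists>x. dense_seq x"
proof -
  have "mtotally_bounded M"
    using compact compact_space_eq_mcomplete_mtotally_bounded by blast
  then have "\<forall>m::nat. \<exists>K. finite K \<and> K \<subseteq> M \<and> M \<subseteq> (\<Union>k\<in>K. mball k (inverse (real (Suc m))))"
    unfolding mtotally_bounded_def by simp
  then obtain K where K: "\<And>m. finite (K m)" "\<And>m. K m \<subseteq> M"
    "\<And>m. M \<subseteq> (\<Union>k\<in>K m. mball k (inverse (real (Suc m))))"
    by metis
  let ?S = "\<Union>m. K m"
  have "countable ?S" using K by (simp add: countable_finite)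
  moreover have "?S \<noteq> {}" using K(3)[of 0] M_ne by auto
  ultimately have r: "range (from_nat_into ?S) = ?S" by (simp add: range_from_nat_into)
  have "\<exists>n. d z (from_nat_into ?S n) < e" if "z \<in> M" "0 < e" for z e
  proof -
    obtain m where m: "inverse (real (Suc m)) < e"
      using reals_Archimedean[OF \<open>0 < e\<close>] by auto
    obtain k where "k \<in> K m" "d k z < inverse (real (Suc m))"
      using K(3)[of m] \<open>z \<in> M\<close> by auto
    then have "k \<in> range (from_nat_into ?S)" "d z k < e"
      using m commute[of k z] unfolding r by auto
    then show ?thesis by auto
  qed
  then show ?thesis
    using K(2) unfolding dense_seq_def r by (intro exI[of _ "from_nat_into ?S"]) (auto simp: r)
qed

text \<open>This makes sampling injective. If \<open>a z\<close> and \<open>b z\<close> differ, then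
  near \<open>z\<close> each function stays within half their distance, which is impossible at a
  sample point where they agree.\<close>

lemma CM_eq_on_dense:
  assumes "dense_seq x" "a \<in> CM" "b \<in> CM" "\<And>n. a (x n) = b (x n)"
  shows "a = b"
proof (rule extensionalityI[of _ M])
  fix z assume z: "z \<in> M"
  show "a z = b z"
  proof (rule ccontr)
    assume "a z \<noteq> b z"
    then have e: "0 < dist (a z) (b z) / 2" by simp
    have "continuous_map mtopology euclidean a" "continuous_map mtopology euclidean b"
      using assms(2,3) by auto
    then obtain r s where rs: "0 < r" "\<And>x. x \<in> M \<Longrightarrow> d z x < r \<Longrightarrow> dist (a z) (a x) < dist (a z) (b z) / 2"
      "0 < s" "\<And>x. x \<in> M \<Longrightarrow> d z x < s \<Longrightarrow> dist (b z) (b x) < dist (a z) (b z) / 2"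
      using z e unfolding continuous_map_metric_iff by metis
    obtain n where "d z (x n) < min r s"
      using assms(1) z rs(1,3) unfolding dense_seq_def by (metis min_less_iff_conj)
    moreover have "x n \<in> M" using assms(1) by (auto simp: dense_seq_def)
    ultimately have "dist (a z) (a (x n)) < dist (a z) (b z) / 2" "dist (b z) (a (x n)) < dist (a z) (b z) / 2"
      using rs(2)[of "x n"] rs(4)[of "x n"] assms(4)[of n] by (simp_all only: min_less_iff_conj)
    then show False using dist_triangle2[of "a z" "b z" "a (x n)"] by linarith
  qed
qed (use assms in auto)

abbreviation sample :: "((nat \<Rightarrow> complex) \<Rightarrow> 'u) \<Rightarrow> (nat \<Rightarrow> 'a) \<Rightarrow> ('a \<Rightarrow> complex) \<Rightarrow> 'u" where
  "sample J x f \<equiv> J (\<lambda>n. f (x n))"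

lemma sample_hom:
  assumes J: "inj J" and x: "dense_seq x"
  shows "unital_inj_star_hom (CX M d) (transport J linf) (sample J x)"
proof -
  have xM: "x n \<in> M" for n using x by (auto simp: dense_seq_def)
  have "bounded (range (\<lambda>n. f (x n)))" if "f \<in> CM" for f
    using norm_le_sup_norm[OF that xM] unfolding bounded_iff by blast
  moreover have "inj_on (sample J x) CM"
  proof (rule inj_onI)
    fix a b assume ab: "a \<in> CM" "b \<in> CM" "sample J x a = sample J x b"
    then have "(\<lambda>n. a (x n)) = (\<lambda>n. b (x n))" using J by (simp add: inj_eq)
    then show "a = b" using CM_eq_on_dense[OF x ab(1,2)] by metis
  qed
  ultimately show ?thesis
    unfolding unital_inj_star_hom_def CX_sel transport_sel[OF J] linf_sel
    using xM by auto
qed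

text \<open>Taking the centres of the partition in the range of \<open>x\<close> turns evaluation at
  a centre into evaluation of a sequence at an index, hence into a state of the sequence algebra. In
  the other direction, a pulled-back state is itself a state of C(M), at distance 0 from
  itself.\<close>

lemma height_le:
  fixes J :: "(nat \<Rightarrow> complex) \<Rightarrow> 'u"
  assumes J: "inj J" and x: "dense_seq x" and "0 < e"
  shows "haus mkd (states (CX M d))
    (pullback (CX M d) (sample J x) ` one_level (transport J linf) (cone (transport J linf))) \<le> ereal e"
proof -
  let ?D = "transport J linf"
  have D: "unital_cstar_alg ?D"
    by (rule unital_cstar_alg_transport[OF J linf.unital_cstar_alg_fun_cstar])
  have xM: "x n \<in> M" for n using x by (auto simp: dense_seq_def)
  have pb: "pullback (CX M d) (sample J x) \<omega> \<in> states (CX M d)" if "\<omega> \<in> states ?D" for \<omega>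
    using pullback_state[OF _ sample_hom[OF J x] that] unital_cstar_alg_fun_cstar by (simp add: CX_eq)
  have "\<exists>\<omega>\<in>states ?D. mkd \<phi> (pullback (CX M d) (sample J x) \<omega>) \<le> e"
    if \<phi>: "\<phi> \<in> states (CX M d)" for \<phi>
  proof -
    obtain K p where K: "K \<subseteq> range x" and p: "subordinate_partition e K p"
      using subordinate_partition_exists[of e "range x"] x \<open>0 < e\<close> unfolding dense_seq_def
      by (metis rangeI)
    have "\<forall>k\<in>K. \<exists>n. x n = k" using K by blast
    from bchoice[OF this] obtain n where n: "\<And>k. k \<in> K \<Longrightarrow> x (n k) = k" by blast
    define \<omega> where "\<omega> = (\<lambda>u. if u \<in> cset ?D then
      \<Sum>k\<in>K. complex_of_real (expect \<phi> (p k)) * inv J u (n k) else 0)"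
    have \<omega>: "\<omega> \<in> states ?D"
      unfolding \<omega>_def by (rule convex_state[OF J expect_partition[OF \<phi> p]])
    have "mkd \<phi> (pullback (CX M d) (sample J x) \<omega>) \<le> e"
    proof (rule mkd_le[OF \<phi> pb[OF \<omega>]])
      fix g assume g: "lip 1 g"
      have e: "emb g \<in> CM" by (rule emb_in_CM[OF lip_imp_cont[OF g]])
      then have "sample J x (emb g) \<in> cset ?D"
        using sample_hom[OF J x] unfolding unital_inj_star_hom_def CX_sel by blast
      then have "pullback (CX M d) (sample J x) \<omega> (emb g)
          = (\<Sum>k\<in>K. complex_of_real (expect \<phi> (p k)) * emb g (x (n k)))"
        using e J by (simp add: pullback_def CX_sel \<omega>_def)
      also have "\<dots> = of_real (\<Sum>k\<in>K. g k * expect \<phi> (p k))"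
        unfolding of_real_sum
      proof (rule sum.cong[OF refl])
        fix k assume "k \<in> K"
        then show "complex_of_real (expect \<phi> (p k)) * emb g (x (n k)) = of_real (g k * expect \<phi> (p k))"
          using n emb_apply[OF xM, of g "n k"] by simp
      qed
      finally show "\<bar>expect \<phi> g - expect (pullback (CX M d) (sample J x) \<omega>) g\<bar> \<le> e"
        using expect_partition_approx[OF \<phi> p g] by simp
    qed
    with \<omega> show ?thesis by blast
  qed
  then show ?thesis
    unfolding one_level_cone[OF D] using pb \<open>0 < e\<close>
    by (intro haus_le) (auto intro!: bexI[where P = "\<lambda>s. mkd s _ \<le> e", OF _ pb] simp: mk_refl)
qed

end

text \<open>McShane extension across two spaces: \<open>c\<close> gives the distances between points of \<open>X\<close> and of \<open>Y\<close>.\<close>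
lemma lipschitz_extension:
  fixes f :: "'a \<Rightarrow> real" and c :: "'a \<Rightarrow> 'b \<Rightarrow> real"
  assumes "X \<noteq> {}"
    and f: "\<And>x x' y. x \<in> X \<Longrightarrow> x' \<in> X \<Longrightarrow> y \<in> Y \<Longrightarrow> f x - f x' \<le> c x y + c x' y"
    and c: "\<And>x y y'. x \<in> X \<Longrightarrow> y \<in> Y \<Longrightarrow> y' \<in> Y \<Longrightarrow> c x y \<le> c x y' + dY y y'"
    and sym: "\<And>y y'. dY y y' = dY y' y"
  obtains g where "\<And>y y'. y \<in> Y \<Longrightarrow> y' \<in> Y \<Longrightarrow> \<bar>g y - g y'\<bar> \<le> dY y y'"
    and "\<And>x y. x \<in> X \<Longrightarrow> y \<in> Y \<Longrightarrow> \<bar>f x - g y\<bar> \<le> c x y"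
proof -
  \<comment> \<open>McShane's infimum, with cross-distances in place of a metric. Hypothesis
    \<open>f\<close> bounds it below by \<open>f x0 - c x0 y\<close>; in the applications that
    hypothesis is the 1-Lipschitz bound followed by the triangle inequality through
    \<open>y\<close>.\<close>
  define g where "g y = (INF x\<in>X. f x + c x y)" for y
  obtain x0 where x0: "x0 \<in> X" using assms(1) by blast
  have low: "f x - c x y \<le> f x' + c x' y" if "x \<in> X" "x' \<in> X" "y \<in> Y" for x x' y
    using f[OF that] by linarith
  then have bd: "bdd_below ((\<lambda>x. f x + c x y) ` X)" if "y \<in> Y" for y
    using x0 that by (intro bdd_belowI2) blast
  have gle: "g y \<le> f x + c x y" if "x \<in> X" "y \<in> Y" for x y
    unfolding g_def by (rule cINF_lower[OF bd[OF that(2)] that(1)])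
  have gge: "b \<le> g y" if "\<And>x. x \<in> X \<Longrightarrow> b \<le> f x + c x y" for b y
    unfolding g_def by (rule cINF_greatest[OF assms(1) that])
  have half: "g y - dY y y' \<le> g y'" if "y \<in> Y" "y' \<in> Y" for y y'
  proof (rule gge)
    fix x assume "x \<in> X"
    then show "g y - dY y y' \<le> f x + c x y'"
      using gle[of x y] c[of x y y'] that by linarith
  qed
  show ?thesis
  proof (rule that)
    show "\<bar>g y - g y'\<bar> \<le> dY y y'" if "y \<in> Y" "y' \<in> Y" for y y'
      using half[OF that] half[OF that(2,1)] sym[of y y'] by linarith
    show "\<bar>f x - g y\<bar> \<le> c x y" if "x \<in> X" "y \<in> Y" for x y
      using gle[OF that] gge[OF low[OF that(1) _ that(2)]] by linarith
  qed
qed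

lemma haus_lessD:
  assumes "haus d S T < r"
  shows "s \<in> S \<Longrightarrow> \<exists>t\<in>T. ereal (d s t) < r" and "t \<in> T \<Longrightarrow> \<exists>s\<in>S. ereal (d s t) < r"
proof -
  show "\<exists>t\<in>T. ereal (d s t) < r" if "s \<in> S"
  proof -
    have "(INF t\<in>T. ereal (d s t)) \<le> haus d S T"
      unfolding haus_def by (intro max.coboundedI1 SUP_upper that)
    then show ?thesis using assms by (meson INF_less_iff order_le_less_trans)
  qed
  show "\<exists>s\<in>S. ereal (d s t) < r" if "t \<in> T"
  proof -
    have "(INF s\<in>S. ereal (d s t)) \<le> haus d S T"
      unfolding haus_def by (intro max.coboundedI2 SUP_upper that)
    then show ?thesis using assms by (meson INF_less_iff order_le_less_trans)
  qed
qed

text \<open>Both samplings use the same index, so the distance between the images of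
  \<open>f\<close> and \<open>g\<close> only sees the matched pairs \<open>x n\<close>,
  \<open>y n\<close>. There a bound of \<open>\<bar>f a - g b\<bar>\<close> by the cross-distance
  becomes a bound by \<open>r\<close>.\<close>

lemma bridge_length_sample_le:
  fixes J :: "(nat \<Rightarrow> complex) \<Rightarrow> 'u" and X :: "'a set" and Y :: "'b set"
  assumes X: "compact_metric X dX" and Y: "compact_metric Y dY" and J: "inj J"
    and x: "compact_metric.dense_seq X dX x" and y: "compact_metric.dense_seq Y dY y"
    and d: "Metric_space (Inl ` X \<union> Inr ` Y) d"
    and dX: "\<And>x x'. x \<in> X \<Longrightarrow> x' \<in> X \<Longrightarrow> d (Inl x) (Inl x') = dX x x'"
    and dY: "\<And>y y'. y \<in> Y \<Longrightarrow> y' \<in> Y \<Longrightarrow> d (Inr y) (Inr y') = dY y y'"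
    and r: "0 < r" "\<And>n. d (Inl (x n)) (Inr (y n)) \<le> r"
  defines "\<beta> \<equiv> \<lparr>bD = transport J linf, bw = cone (transport J linf),
     bl = (\<lambda>f. J (\<lambda>n. f (x n))), br = (\<lambda>f. J (\<lambda>n. f (y n)))\<rparr>"
  shows "is_bridge (CX X dX) (CX Y dY) \<beta>"
    and "bridge_length (CX X dX) (LipX X dX) (CX Y dY) (LipX Y dY) \<beta> \<le> ereal r"
proof -
  interpret X: compact_metric X dX by (rule X)
  interpret Y: compact_metric Y dY by (rule Y)
  interpret XY: Metric_space "Inl ` X \<union> Inr ` Y" d by (rule d)
  let ?D = "transport J linf"
  have D: "unital_cstar_alg ?D"
    by (rule unital_cstar_alg_transport[OF J linf.unital_cstar_alg_fun_cstar])
  have xX: "x n \<in> X" and yY: "y n \<in> Y" for n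
    using x y unfolding X.dense_seq_def Y.dense_seq_def by auto
  \<comment> \<open>Evaluation at a single index, a convex combination with one term, shows that the
    1-level is nonempty.\<close>
  have "\<exists>\<omega>. \<omega> \<in> one_level ?D (cone ?D)"
    unfolding one_level_cone[OF D]
    using convex_state[OF J, of "{0::nat}" "\<lambda>_. 1"] by auto
  then show "is_bridge (CX X dX) (CX Y dY) \<beta>"
    unfolding is_bridge_def \<beta>_def
    using D unital_cstar_alg_closed(2)[OF D] X.sample_hom[OF J x] Y.sample_hom[OF J y] by auto
  have tri: "d u w \<le> d u v + d v w"
    if "u \<in> Inl ` X \<union> Inr ` Y" "v \<in> Inl ` X \<union> Inr ` Y" "w \<in> Inl ` X \<union> Inr ` Y" for u v w
    using XY.triangle that by blast
  have cdist: "cdist ?D (J (\<lambda>n. X.emb f (x n))) (J (\<lambda>n. Y.emb g (y n))) \<le> r"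
    if "\<And>a b. a \<in> X \<Longrightarrow> b \<in> Y \<Longrightarrow> \<bar>f a - g b\<bar> \<le> d (Inl a) (Inr b)" for f g
    unfolding transport_sel(10)[OF J]
  proof (rule linf.cdist_le)
    fix n
    have "cmod (X.emb f (x n) - Y.emb g (y n)) = \<bar>f (x n) - g (y n)\<bar>"
      using xX yY by (simp flip: of_real_diff)
    then show "cmod (X.emb f (x n) - Y.emb g (y n)) \<le> r"
      using that[OF xX yY, of n n] r(2)[of n] by linarith
  qed
  have "haus (cdist ?D) ((\<lambda>f. J (\<lambda>n. f (x n))) ` Lip1 (CX X dX) (LipX X dX))
    ((\<lambda>f. J (\<lambda>n. f (y n))) ` Lip1 (CX Y dY) (LipX Y dY)) \<le> ereal r"
    unfolding X.Lip1_CX Y.Lip1_CX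
  proof (rule haus_le)
    fix s assume "s \<in> (\<lambda>f. J (\<lambda>n. f (x n))) ` {X.emb g |g. X.lip 1 g}"
    then obtain f where f: "s = J (\<lambda>n. X.emb f (x n))" "X.lip 1 f" by blast
    have "f a - f a' \<le> d (Inl a) (Inr b) + d (Inl a') (Inr b)" if "a \<in> X" "a' \<in> X" "b \<in> Y" for a a' b
    proof -
      have "\<bar>f a - f a'\<bar> \<le> 1 * dX a a'" using f(2) that by blast
      then show ?thesis
        using tri[of "Inl a" "Inr b" "Inl a'"] XY.commute[of "Inl a'" "Inr b"] dX[OF that(1,2)] that by auto
    qed
    moreover have "d (Inl a) (Inr b) \<le> d (Inl a) (Inr b') + dY b b'"
      if "a \<in> X" "b \<in> Y" "b' \<in> Y" for a b b'
      using tri[of "Inl a" "Inr b'" "Inr b"] dY[of b' b] Y.commute[of b b'] that by auto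
    ultimately obtain g where g: "\<And>b b'. b \<in> Y \<Longrightarrow> b' \<in> Y \<Longrightarrow> \<bar>g b - g b'\<bar> \<le> dY b b'"
      "\<And>a b. a \<in> X \<Longrightarrow> b \<in> Y \<Longrightarrow> \<bar>f a - g b\<bar> \<le> d (Inl a) (Inr b)"
      using lipschitz_extension[OF X.M_ne, of Y f "\<lambda>a b. d (Inl a) (Inr b)" dY] Y.commute by metis
    have "Y.lip 1 g" using g(1) by simp
    then show "\<exists>t\<in>(\<lambda>f. J (\<lambda>n. f (y n))) ` {Y.emb g |g. Y.lip 1 g}. cdist ?D s t \<le> r"
      using cdist[OF g(2)] unfolding f(1) by blast
  next
    fix t assume "t \<in> (\<lambda>f. J (\<lambda>n. f (y n))) ` {Y.emb g |g. Y.lip 1 g}"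
    then obtain g where g: "t = J (\<lambda>n. Y.emb g (y n))" "Y.lip 1 g" by blast
    \<comment> \<open>The extension is used again with the two spaces exchanged, reading the
      cross-distance with its arguments swapped.\<close>
    have "g b - g b' \<le> d (Inl a) (Inr b) + d (Inl a) (Inr b')" if "b \<in> Y" "b' \<in> Y" "a \<in> X" for a b b'
    proof -
      have "\<bar>g b - g b'\<bar> \<le> 1 * dY b b'" using g(2) that by blast
      then show ?thesis
        using tri[of "Inr b" "Inl a" "Inr b'"] XY.commute[of "Inl a" "Inr b"] dY[OF that(1,2)] that by auto
    qed
    moreover have "d (Inl a) (Inr b) \<le> d (Inl a') (Inr b) + dX a a'"
      if "b \<in> Y" "a \<in> X" "a' \<in> X" for a a' b
      using tri[of "Inl a" "Inl a'" "Inr b"] dX[of a a'] that by auto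
    ultimately obtain f where f: "\<And>a a'. a \<in> X \<Longrightarrow> a' \<in> X \<Longrightarrow> \<bar>f a - f a'\<bar> \<le> dX a a'"
      "\<And>b a. b \<in> Y \<Longrightarrow> a \<in> X \<Longrightarrow> \<bar>g b - f a\<bar> \<le> d (Inl a) (Inr b)"
      using lipschitz_extension[OF Y.M_ne, of X g "\<lambda>b a. d (Inl a) (Inr b)" dX] X.commute by metis
    have "\<bar>f a - g b\<bar> \<le> d (Inl a) (Inr b)" if "a \<in> X" "b \<in> Y" for a b
      using f(2)[OF that(2,1)] by (simp add: abs_minus_commute)
    note c = cdist[OF this]
    have "X.lip 1 f" using f(1) by simp
    then show "\<exists>s\<in>(\<lambda>f. J (\<lambda>n. f (x n))) ` {X.emb g |g. X.lip 1 g}. cdist ?D s t \<le> r"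
      using c unfolding g(1) by blast
  qed
  then have "bridge_reach (CX X dX) (LipX X dX) (CX Y dY) (LipX Y dY) \<beta> \<le> ereal r"
    unfolding bridge_reach_def \<beta>_def by (simp add: transport_sel[OF J] linf_sel)
  \<comment> \<open>\<open>height_le\<close> holds for every positive tolerance, and
    \<open>r\<close> itself is taken.\<close>
  moreover have "bridge_height (CX X dX) (LipX X dX) (CX Y dY) (LipX Y dY) \<beta> \<le> ereal r"
    unfolding bridge_height_def \<beta>_def
    using X.height_le[OF J x r(1)] Y.height_le[OF J y r(1)] by simp
  ultimately show "bridge_length (CX X dX) (LipX X dX) (CX Y dY) (LipX Y dY) \<beta> \<le> ereal r"
    unfolding bridge_length_def by simp
qed

text \<open>Even indices run through a dense sequence of \<open>X\<close> and odd ones through a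
  dense sequence of \<open>Y\<close>, each point paired with a chosen partner in the other space.
  Each sequence is dense because one of its two halves already is.\<close>

lemma paired_dense_seqs:
  assumes X: "compact_metric X dX" and Y: "compact_metric Y dY"
    and R: "\<And>x. x \<in> X \<Longrightarrow> \<exists>y\<in>Y. R x y" "\<And>y. y \<in> Y \<Longrightarrow> \<exists>x\<in>X. R x y"
  obtains x y where "compact_metric.dense_seq X dX x" "compact_metric.dense_seq Y dY y"
    "\<And>n. R (x n) (y n)"
proof -
  interpret X: compact_metric X dX by (rule X)
  interpret Y: compact_metric Y dY by (rule Y)
  obtain u where u: "X.dense_seq u" using X.dense_seq_exists by blast
  obtain v where v: "Y.dense_seq v" using Y.dense_seq_exists by blast
  obtain f where f: "\<And>x. x \<in> X \<Longrightarrow> f x \<in> Y \<and> R x (f x)" using R(1) by metis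
  obtain g where g: "\<And>y. y \<in> Y \<Longrightarrow> g y \<in> X \<and> R (g y) y" using R(2) by metis
  have uX: "u n \<in> X" and vY: "v n \<in> Y" for n
    using u v unfolding X.dense_seq_def Y.dense_seq_def by auto
  define x where "x n = (if even n then u (n div 2) else g (v (n div 2)))" for n
  define y where "y n = (if even n then f (u (n div 2)) else v (n div 2))" for n
  have xu: "x (2 * n) = u n" and yv: "y (2 * n + 1) = v n" for n
    by (simp_all add: x_def y_def)
  show ?thesis
  proof (rule that)
    have "\<exists>n. dX z (x n) < e" if "z \<in> X" "0 < e" for z e
      using u that xu unfolding X.dense_seq_def by metis
    then show "X.dense_seq x"
      unfolding X.dense_seq_def using uX g vY by (auto simp: x_def)
    have "\<exists>n. dY z (y n) < e" if "z \<in> Y" "0 < e" for z e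
      using v that yv unfolding Y.dense_seq_def by metis
    then show "Y.dense_seq y"
      unfolding Y.dense_seq_def using uX f vY by (auto simp: y_def)
    show "R (x n) (y n)" for n
      using f g uX vY by (auto simp: x_def y_def)
  qed
qed

theorem mainTheorem16:
  fixes X :: "'a set" and dX :: "'a \<Rightarrow> 'a \<Rightarrow> real"
    and Y :: "'b set" and dY :: "'b \<Rightarrow> 'b \<Rightarrow> real"
  assumes "Metric_space X dX" "compact_space (Metric_space.mtopology X dX)" "X \<noteq> {}"
      and "Metric_space Y dY" "compact_space (Metric_space.mtopology Y dY)" "Y \<noteq> {}"
      and "\<exists>f :: real \<Rightarrow> 'u. inj f"
  shows "propinquity TYPE('u) (CX X dX) (LipX X dX) (CX Y dY) (LipX Y dY) \<le> GH X dX Y dY"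
proof -
  have X: "compact_metric X dX" and Y: "compact_metric Y dY"
    using assms by (simp_all add: compact_metric_def compact_metric_axioms_def)
  obtain h :: "real \<Rightarrow> 'u" where h: "inj h" using assms(7) by blast
  obtain k :: "(nat \<Rightarrow> complex) \<Rightarrow> real" where k: "inj k" using inj_sequences_complex_real by blast
  have J: "inj (h \<circ> k)" using h k by (rule inj_compose)
  show ?thesis
    unfolding GH_def
  proof (rule Inf_greatest, elim CollectE exE conjE)
    fix D d
    assume D: "D = haus d (Inl ` X) (Inr ` Y)" and d: "Metric_space (Inl ` X \<union> Inr ` Y) d"
      and dX: "\<forall>x\<in>X. \<forall>x'\<in>X. d (Inl x) (Inl x') = dX x x'"
      and dY: "\<forall>y\<in>Y. \<forall>y'\<in>Y. d (Inr y) (Inr y') = dY y y'"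
    interpret XY: Metric_space "Inl ` X \<union> Inr ` Y" d by (rule d)
    show "propinquity TYPE('u) (CX X dX) (LipX X dX) (CX Y dY) (LipX Y dY) \<le> D"
    \<comment> \<open>Bounding by every \<open>r\<close> above \<open>D\<close> is enough, and the
      strict inequality yields partners at distance below \<open>r\<close> directly from the
      infima.\<close>
    proof (rule dense_ge)
      fix r assume r: "D < r"
      show "propinquity TYPE('u) (CX X dX) (LipX X dX) (CX Y dY) (LipX Y dY) \<le> r"
      proof (cases r)
        case (real t)
        note near = haus_lessD[OF r[unfolded D real], unfolded less_ereal.simps(1)]
        have "\<exists>y\<in>Y. d (Inl x) (Inr y) < t" if "x \<in> X" for x
          using near(1)[of "Inl x"] that by auto
        moreover have "\<exists>x\<in>X. d (Inl x) (Inr y) < t" if "y \<in> Y" for y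
          using near(2)[of "Inr y"] that by auto
        ultimately obtain x y where xy: "compact_metric.dense_seq X dX x" "compact_metric.dense_seq Y dY y"
          "\<And>n. d (Inl (x n)) (Inr (y n)) < t"
          using paired_dense_seqs[OF X Y, of "\<lambda>a b. d (Inl a) (Inr b) < t"] by blast
        have "0 < t" using xy(3)[of 0] XY.nonneg order_le_less_trans by blast
        note bridge = bridge_length_sample_le[OF X Y J xy(1,2) d _ _ this less_imp_le[OF xy(3)]]
        \<comment> \<open>A single bridge is already a trek, so the first of the two families in
          \<open>trek_lengths\<close> supplies the upper bound.\<close>
        have "propinquity TYPE('u) (CX X dX) (LipX X dX) (CX Y dY) (LipX Y dY) \<le> ereal t"
          unfolding propinquity_def trek_lengths_def
        proof (rule Inf_lower2[OF UnI1])
          show "bridge_length (CX X dX) (LipX X dX) (CX Y dY) (LipX Y dY)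
              \<lparr>bD = transport (h \<circ> k) linf, bw = cone (transport (h \<circ> k) linf),
               bl = (\<lambda>f. (h \<circ> k) (\<lambda>n. f (x n))), br = (\<lambda>f. (h \<circ> k) (\<lambda>n. f (y n)))\<rparr> \<le> ereal t"
            using dX dY by (intro bridge(2)) auto
        qed (use bridge(1) dX dY compact_metric.leibniz_qcms_CX[OF X] compact_metric.leibniz_qcms_CX[OF Y]
              in blast)
        then show ?thesis using real by simp
      qed (use r in auto)
    qed
  qed
qed

end
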